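(* Let $f:\mathbb{P}^n\to\mathbb{P}^n$ be a holomorphic map of degree at least $2$. Let $\Omega$ be a Fatou component of $f$ which is preperiodic to a basin of attraction; that is, there are integers $m\ge 0$ and $k\ge 1$ such that $W:=f^m(\Omega)$ is a Fatou component with $f^k(W)=W$, and $W$ is the basin of attraction of an attracting fixed point $p\in W$ of $f^k$. Then $\Omega$ is Kobayashi complete.
   Context: $\mathbb{P}^n$ is complex projective space of dimension $n\ge 1$; a holomorphic self-map of degree $d$ is one given in homogeneous coordinates by homogeneous polynomials of degree $d$ whose only common zero is the origin. Fatou components: the Fatou set of $f$ is the set of points having a neighborhood on which the family of iterates $\{f^j\}_{j\ge 0}$ is normal (since $\mathbb{P}^n$ is compact: every sequence of iterates has a subsequence converging uniformly on compact sets); its connected components are the Fatou components. Basin of attraction: $p$ is an attracting fixed point of $g=f^k$ if $g(p)=p$ and all eigenvalues of the derivative $Dg(p)$ have modulus less than $1$; a Fatou component $W\ni p$ with $g(W)=W$ is the basin of attraction of $p$ if $g^j\to p$ uniformly on compact subsets of $W$ as $j\to\infty$. Kobayashi completeness: $d_K$ denotes the Kobayashi pseudodistance of a connected complex manifold. The manifold is Kobayashi hyperbolic if $d_K$ is a distance, and a hyperbolic manifold is Kobayashi complete if every sequence that is Cauchy for $d_K$ converges to a point of the manifold. (By a theorem of Ueda, every Fatou component of a holomorphic self-map of $\mathbb{P}^n$ of degree at least 2 is Kobayashi hyperbolic.) *)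

theory Defs
  imports "HOL-Analysis.Analysis"
begin

section \<open>Complex projective space\<close>

text \<open>
  Homogeneous coordinates are indexed by the finite type \<open>'n\<close>, so \<open>'n cproj\<close> is the complex
  projective space of dimension \<open>CARD('n) - 1\<close>.
\<close>

definition projrel :: "complex^'n::finite \<Rightarrow> complex^'n \<Rightarrow> bool" where
  "projrel x y \<longleftrightarrow> x \<noteq> 0 \<and> y \<noteq> 0 \<and> (\<exists>c. y = c *s x)"

lemma projrel_nonzero_scalar:
  assumes "projrel x y"
  obtains c where "c \<noteq> 0" "y = c *s x" "x \<noteq> 0" "y \<noteq> 0"
  using assms by (auto simp: projrel_def)

lemma projrel_self: "x \<noteq> 0 \<Longrightarrow> projrel x x"
  by (auto simp: projrel_def intro!: exI[of _ 1])

lemma projrel_part_equivp: "part_equivp (projrel :: complex^'n::finite \<Rightarrow> complex^'n \<Rightarrow> bool)"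
proof (rule part_equivpI)
  have "projrel (vec 1 :: complex^'n) (vec 1)"
    unfolding projrel_def by (auto simp: vec_eq_iff intro!: exI[of _ 1])
  then show "\<exists>x. projrel (x :: complex^'n) x" by blast
next
  show "symp (projrel :: complex^'n \<Rightarrow> complex^'n \<Rightarrow> bool)"
  proof (rule sympI)
    fix x y :: "complex^'n"
    assume "projrel x y"
    then obtain c where c: "c \<noteq> 0" "y = c *s x" "x \<noteq> 0" "y \<noteq> 0"
      by (rule projrel_nonzero_scalar)
    then have "x = inverse c *s y"
      by (simp add: vector_smult_assoc)
    with c show "projrel y x"
      unfolding projrel_def by blast
  qed
next
  show "transp (projrel :: complex^'n \<Rightarrow> complex^'n \<Rightarrow> bool)"
    by (rule transpI) (auto simp: projrel_def vector_smult_assoc)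
qed

text \<open>\<open>hpoint x\<close> is the point with homogeneous coordinates \<open>x\<close>; it is meaningful only for \<open>x \<noteq> 0\<close>.\<close>

quotient_type 'n cproj = "complex^('n::finite)" / partial: projrel
  morphisms rep_cproj hpoint
  by (rule projrel_part_equivp)

lemma hpoint_eq_iff:
  assumes "x \<noteq> 0" "y \<noteq> 0"
  shows "hpoint x = hpoint y \<longleftrightarrow> (\<exists>c. y = c *s x)"
proof -
  have "projrel x x" "projrel y y"
    using assms by (simp_all add: projrel_self)
  then show ?thesis
    using Quotient_rel[OF Quotient_cproj, of x y] assms by (auto simp: projrel_def)
qed

lemma hpoint_cases:
  obtains x where "x \<noteq> 0" "p = hpoint x"
proof -
  have "\<exists>x. x \<noteq> 0 \<and> p = hpoint x"
    by (induction p rule: cproj.abs_induct) (auto simp: projrel_def)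
  with that show thesis by blast
qed

text \<open>
  The metric is obtained by identifying a line with the matrix of the orthogonal projection onto
  it. It is equivalent to the Fubini--Study metric; lemma \<open>open_cproj_iff\<close> below shows that it
  induces the quotient topology.
\<close>

lift_definition line_projection :: "'n::finite cproj \<Rightarrow> complex^'n^'n" is
  "\<lambda>x. \<chi> i j. x $ i * cnj (x $ j) / complex_of_real ((norm x)\<^sup>2)"
proof -
  fix x y :: "complex^'n"
  assume "projrel x y"
  then obtain c where c: "c \<noteq> 0" "y = c *s x" "x \<noteq> 0"
    by (rule projrel_nonzero_scalar)
  have "(norm y)\<^sup>2 = (cmod c)\<^sup>2 * (norm x)\<^sup>2"
    unfolding c by (simp add: norm_vec_def L2_set_def norm_mult power_mult_distrib sum_nonneg sum_distrib_left)
  then have n: "complex_of_real ((norm y)\<^sup>2) = (c * cnj c) * complex_of_real ((norm x)\<^sup>2)"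
    by (simp add: complex_norm_square[symmetric])
  have "y $ i * cnj (y $ j) / complex_of_real ((norm y)\<^sup>2)
        = x $ i * cnj (x $ j) / complex_of_real ((norm x)\<^sup>2)" for i j
    unfolding n using c by (simp add: field_simps)
  then show "(\<chi> i j. x $ i * cnj (x $ j) / complex_of_real ((norm x)\<^sup>2)) =
             (\<chi> i j. y $ i * cnj (y $ j) / complex_of_real ((norm y)\<^sup>2))"
    by simp
qed

lemma line_projection_hpoint:
  assumes "x \<noteq> 0"
  shows "line_projection (hpoint x) = (\<chi> i j. x $ i * cnj (x $ j) / complex_of_real ((norm x)\<^sup>2))"
proof -
  have "projrel x x"
    using assms by (simp_all add: projrel_self)
  then show ?thesis by (simp add: line_projection.abs_eq)
qed

lemma sum_cnj_self: "(\<Sum>j\<in>UNIV. cnj (x $ j) * x $ j) = complex_of_real ((norm (x::complex^'n::finite))\<^sup>2)"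
proof -
  have "(norm x)\<^sup>2 = (\<Sum>j\<in>UNIV. (cmod (x $ j))\<^sup>2)"
    by (simp add: norm_vec_def L2_set_def sum_nonneg)
  then show ?thesis
    by (simp add: complex_norm_square mult.commute del: of_real_power)
qed

lemma line_projection_mult:
  assumes "x \<noteq> 0"
  shows "line_projection (hpoint x) *v y
         = ((\<Sum>j\<in>UNIV. cnj (x $ j) * y $ j) / complex_of_real ((norm x)\<^sup>2)) *s x"
  unfolding line_projection_hpoint[OF assms]
  by (simp add: vec_eq_iff matrix_vector_mult_def sum_distrib_left sum_distrib_right
      sum_divide_distrib mult_ac)

lemma line_projection_self:
  assumes "x \<noteq> 0"
  shows "line_projection (hpoint x) *v x = x"
  using assms by (simp add: line_projection_mult sum_cnj_self del: of_real_power)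

lemma line_projection_inject: "line_projection p = line_projection q \<longleftrightarrow> p = q"
proof
  assume eq: "line_projection p = line_projection q"
  obtain x where x: "x \<noteq> 0" "p = hpoint x" by (rule hpoint_cases)
  obtain y where y: "y \<noteq> 0" "q = hpoint y" by (rule hpoint_cases)
  have "y = line_projection (hpoint x) *v y"
    using eq x y line_projection_self by metis
  then have "\<exists>c. y = c *s x"
    using line_projection_mult[OF x(1)] by metis
  then show "p = q"
    using hpoint_eq_iff x y by metis
qed simp

instantiation cproj :: (finite) metric_space
begin

definition dist_cproj :: "'a cproj \<Rightarrow> 'a cproj \<Rightarrow> real" where
  "dist_cproj p q = dist (line_projection p) (line_projection q)"

definition uniformity_cproj :: "('a cproj \<times> 'a cproj) filter" where
  "uniformity_cproj = (INF e\<in>{0<..}. principal {(p, q). dist p q < e})"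

definition open_cproj :: "'a cproj set \<Rightarrow> bool" where
  "open_cproj U \<longleftrightarrow> (\<forall>p\<in>U. eventually (\<lambda>(p', q). p' = p \<longrightarrow> q \<in> U) uniformity)"

instance
proof
  fix p q r :: "'a cproj"
  show "dist p q = 0 \<longleftrightarrow> p = q"
    by (simp add: dist_cproj_def line_projection_inject)
  show "dist p q \<le> dist p r + dist q r"
    unfolding dist_cproj_def by (rule dist_triangle2)
qed (simp_all add: uniformity_cproj_def open_cproj_def)

end

lemma continuous_on_hpoint: "continuous_on {x. x \<noteq> 0} hpoint"
proof -
  have "continuous_on {x. x \<noteq> 0}
    (\<lambda>x::complex^'a. \<chi> i j. x $ i * cnj (x $ j) / complex_of_real ((norm x)\<^sup>2))"
    by (intro continuous_intros) auto
  then have *: "continuous_on {x. x \<noteq> 0} (\<lambda>x::complex^'a. line_projection (hpoint x))"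
    by (rule continuous_on_eq) (simp add: line_projection_hpoint)
  show ?thesis
    using * unfolding continuous_on_iff dist_cproj_def by blast
qed

lemma continuous_on_line_projection: "continuous_on S line_projection"
  unfolding continuous_on_iff dist_cproj_def by blast

lemma open_cproj_iff: "open (U :: 'a::finite cproj set) \<longleftrightarrow> open {x. x \<noteq> 0 \<and> hpoint x \<in> U}"
proof
  assume "open U"
  moreover have "open {x::complex^'a. x \<noteq> 0}"
    by (simp add: open_delete Collect_neg_eq[symmetric] open_Collect_neq)
  ultimately have "open (hpoint -` U \<inter> {x. x \<noteq> 0})"
    using continuous_on_hpoint continuous_on_open_vimage by blast
  also have "hpoint -` U \<inter> {x. x \<noteq> 0} = {x. x \<noteq> 0 \<and> hpoint x \<in> U}" by auto
  finally show "open {x. x \<noteq> 0 \<and> hpoint x \<in> U}" .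
next
  assume op: "open {x. x \<noteq> 0 \<and> hpoint x \<in> U}"
  show "open U"
  proof (subst open_subopen, intro ballI)
    fix p assume p: "p \<in> U"
    obtain x where x: "x \<noteq> 0" "p = hpoint x" by (rule hpoint_cases)
    define h where "h = (\<lambda>q. line_projection q *v x)"
    have "continuous_on UNIV h"
      unfolding h_def matrix_vector_mult_def
      by (intro continuous_intros continuous_on_line_projection)
    then have "open (h -` {x. x \<noteq> 0 \<and> hpoint x \<in> U})"
      using op by (rule open_vimage[rotated])
    moreover have "p \<in> h -` {x. x \<noteq> 0 \<and> hpoint x \<in> U}"
      using x p by (simp add: h_def line_projection_self)
    moreover have "h -` {x. x \<noteq> 0 \<and> hpoint x \<in> U} \<subseteq> U"
    proof
      fix q assume q: "q \<in> h -` {x. x \<noteq> 0 \<and> hpoint x \<in> U}"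
      obtain y where y: "y \<noteq> 0" "q = hpoint y" by (rule hpoint_cases)
      have "\<exists>c. h q = c *s y"
        unfolding h_def y(2) line_projection_mult[OF y(1)] by blast
      then have "q = hpoint (h q)"
        using q y hpoint_eq_iff[of y "h q"] by auto
      with q show "q \<in> U" by auto
    qed
    ultimately show "\<exists>T. open T \<and> p \<in> T \<and> T \<subseteq> U" by blast
  qed
qed

text \<open>
  The \<open>i\<close>-th standard affine chart. It takes values in the affine hyperplane
  \<open>{z. z $ i = 1}\<close>, on which its inverse is \<open>hpoint\<close>.
\<close>

lift_definition in_chart :: "'n::finite \<Rightarrow> 'n cproj \<Rightarrow> bool" is "\<lambda>i x. x $ i \<noteq> 0"
  by (auto elim!: projrel_nonzero_scalar)

lift_definition affine_coords :: "'n::finite \<Rightarrow> 'n cproj \<Rightarrow> complex^'n" is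
  "\<lambda>i x. \<chi> j. x $ j / x $ i"
  by (auto elim!: projrel_nonzero_scalar simp: vec_eq_iff)

lemma in_chart_hpoint: "x \<noteq> 0 \<Longrightarrow> in_chart i (hpoint x) \<longleftrightarrow> x $ i \<noteq> 0"
  by (simp add: in_chart.abs_eq projrel_self)

lemma affine_coords_hpoint: "x \<noteq> 0 \<Longrightarrow> affine_coords i (hpoint x) = (\<chi> j. x $ j / x $ i)"
  by (simp add: affine_coords.abs_eq projrel_self)

lemma hpoint_affine_coords:
  assumes "in_chart i p"
  shows "hpoint (affine_coords i p) = p"
proof -
  obtain x where x: "x \<noteq> 0" "p = hpoint x" by (rule hpoint_cases)
  with assms have i: "x $ i \<noteq> 0" by (simp add: in_chart_hpoint)
  have e: "affine_coords i p = inverse (x $ i) *s x"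
    using x by (simp add: affine_coords_hpoint vec_eq_iff field_simps)
  have "affine_coords i p \<noteq> 0"
    unfolding e using i x by simp
  then show ?thesis
    using hpoint_eq_iff[of x "affine_coords i p"] x e by metis
qed


section \<open>Holomorphic self-maps, Fatou components, basins of attraction\<close>

definition homogeneous_polynomial :: "nat \<Rightarrow> (complex^'n::finite \<Rightarrow> complex) \<Rightarrow> bool" where
  "homogeneous_polynomial d P \<longleftrightarrow>
     (\<exists>c :: ('n \<Rightarrow> nat) \<Rightarrow> complex.
        \<forall>x. P x = (\<Sum>\<alpha> | (\<Sum>i\<in>UNIV. \<alpha> i) = d. c \<alpha> * (\<Prod>i\<in>UNIV. x $ i ^ \<alpha> i)))"

lemma finite_exponents: "finite {\<alpha> :: 'n::finite \<Rightarrow> nat. (\<Sum>i\<in>UNIV. \<alpha> i) = d}"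
proof (rule finite_subset)
  show "{\<alpha> :: 'n \<Rightarrow> nat. (\<Sum>i\<in>UNIV. \<alpha> i) = d} \<subseteq> PiE UNIV (\<lambda>_. {..d})"
    by (auto intro: member_le_sum)
qed (simp add: finite_PiE)

definition holomorphic_selfmap :: "nat \<Rightarrow> ('n::finite cproj \<Rightarrow> 'n cproj) \<Rightarrow> bool" where
  "holomorphic_selfmap d f \<longleftrightarrow>
     (\<exists>F :: complex^'n \<Rightarrow> complex^'n.
        (\<forall>i. homogeneous_polynomial d (\<lambda>x. F x $ i)) \<and>
        (\<forall>x. F x = 0 \<longleftrightarrow> x = 0) \<and>
        (\<forall>x. x \<noteq> 0 \<longrightarrow> f (hpoint x) = hpoint (F x)))"

definition normal_iterates_on :: "'n::finite cproj set \<Rightarrow> ('n cproj \<Rightarrow> 'n cproj) \<Rightarrow> bool" where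
  "normal_iterates_on U f \<longleftrightarrow>
     (\<forall>\<sigma> :: nat \<Rightarrow> nat. \<exists>r g. strict_mono r \<and>
        (\<forall>K. compact K \<and> K \<subseteq> U \<longrightarrow> uniform_limit K (\<lambda>j. f ^^ \<sigma> (r j)) g sequentially))"

definition fatou_set :: "('n::finite cproj \<Rightarrow> 'n cproj) \<Rightarrow> 'n cproj set" where
  "fatou_set f = {x. \<exists>U. open U \<and> x \<in> U \<and> normal_iterates_on U f}"

abbreviation fatou_components :: "('n::finite cproj \<Rightarrow> 'n cproj) \<Rightarrow> 'n cproj set set" where
  "fatou_components f \<equiv> components (fatou_set f)"

text \<open>
  The map \<open>G z = affine_coords i (g (hpoint z))\<close> restricts on the hyperplane \<open>{z. z $ i = 1}\<close> to the
  expression of \<open>g\<close> in the \<open>i\<close>-th chart. The tangent space of that hyperplane is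
  \<open>{v. v $ i = 0}\<close>, and on it the derivative \<open>A\<close> of \<open>G\<close> is the derivative of \<open>g\<close> at \<open>p\<close>.
  In the remaining direction \<open>G\<close> is constant along lines through the origin.
  The eigenvalues do not depend on the chart.
\<close>

definition attracting_fixed_point :: "('n::finite cproj \<Rightarrow> 'n cproj) \<Rightarrow> 'n cproj \<Rightarrow> bool" where
  "attracting_fixed_point g p \<longleftrightarrow>
     g p = p \<and>
     (\<exists>i A. in_chart i p \<and>
        ((\<lambda>z. affine_coords i (g (hpoint z))) has_derivative A) (at (affine_coords i p)) \<and>
        (\<forall>c v. v \<noteq> 0 \<and> v $ i = 0 \<and> A v = c *s v \<longrightarrow> cmod c < 1))"

definition basin_of_attraction ::
  "('n::finite cproj \<Rightarrow> 'n cproj) \<Rightarrow> nat \<Rightarrow> 'n cproj \<Rightarrow> 'n cproj set \<Rightarrow> bool" where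
  "basin_of_attraction f k p W \<longleftrightarrow>
     attracting_fixed_point (f ^^ k) p \<and>
     W \<in> fatou_components f \<and> p \<in> W \<and> (f ^^ k) ` W = W \<and>
     (\<forall>K. compact K \<and> K \<subseteq> W \<longrightarrow> uniform_limit K (\<lambda>j. (f ^^ k) ^^ j) (\<lambda>_. p) sequentially)"


section \<open>The Kobayashi pseudodistance\<close>

definition holomorphic_disc :: "'n::finite cproj set \<Rightarrow> (complex \<Rightarrow> 'n cproj) \<Rightarrow> bool" where
  "holomorphic_disc M \<phi> \<longleftrightarrow>
     \<phi> ` ball 0 1 \<subseteq> M \<and> continuous_on (ball 0 1) \<phi> \<and>
     (\<forall>i j. (\<lambda>z. affine_coords i (\<phi> z) $ j) holomorphic_on {z \<in> ball 0 1. in_chart i (\<phi> z)})"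

definition poincare_dist :: "complex \<Rightarrow> complex \<Rightarrow> real" where
  "poincare_dist a b = 2 * artanh (cmod ((a - b) / (1 - cnj a * b)))"

text \<open>\<open>disc_chain M x y s\<close>: a chain of holomorphic discs in \<open>M\<close> of total length \<open>s\<close> joins \<open>x\<close> to \<open>y\<close>.\<close>

inductive disc_chain :: "'n::finite cproj set \<Rightarrow> 'n cproj \<Rightarrow> 'n cproj \<Rightarrow> real \<Rightarrow> bool"
  for M x where
  refl: "x \<in> M \<Longrightarrow> disc_chain M x x 0"
| step: "disc_chain M x y s \<Longrightarrow> holomorphic_disc M \<phi> \<Longrightarrow> a \<in> ball 0 1 \<Longrightarrow> b \<in> ball 0 1 \<Longrightarrow> \<phi> a = y
    \<Longrightarrow> disc_chain M x (\<phi> b) (s + poincare_dist a b)"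

text \<open>
  The manifold \<open>M\<close> is meant to be a connected open set; then any two of its points are joined by
  a chain, and the infimum is over a nonempty set. The value \<open>0\<close> off \<open>M\<close> is there because
  \<open>Metric_space M d\<close> requires \<open>d\<close> to be nonnegative and symmetric everywhere.
\<close>

definition kobayashi_dist :: "'n::finite cproj set \<Rightarrow> 'n cproj \<Rightarrow> 'n cproj \<Rightarrow> real" where
  "kobayashi_dist M x y = (if x \<in> M \<and> y \<in> M then Inf {s. disc_chain M x y s} else 0)"

definition kobayashi_hyperbolic :: "'n::finite cproj set \<Rightarrow> bool" where
  "kobayashi_hyperbolic M \<longleftrightarrow> Metric_space M (kobayashi_dist M)"

definition kobayashi_complete :: "'n::finite cproj set \<Rightarrow> bool" where
  "kobayashi_complete M \<longleftrightarrow>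
     kobayashi_hyperbolic M \<and> Metric_space.mcomplete M (kobayashi_dist M)"

end

theory Submission
  imports Defs "HOL-Complex_Analysis.Riemann_Mapping"
begin

text \<open>
  Let \<open>F\<close> be a homogeneous lift of \<open>f\<close> and let \<open>\<phi>\<close> be a holomorphic disc in \<open>\<Omega>\<close>. A late iterate
  \<open>f^n\<close> maps the half disc into a fixed small neighborhood of \<open>p\<close>, contained in an affine chart \<open>i\<close>.
  If the representatives of \<open>\<phi>\<close> are normalized by \<open>(F^n s)_i = 1\<close>, they stay in an annulus
  \<open>r \<le> |s| \<le> R\<close> independent of \<open>n\<close>. They are determined up to roots of unity of order \<open>d^n\<close>, so the
  powers \<open>(s_k)^(d^n)\<close> are holomorphic functions on the half disc. One of them is large at \<open>0\<close>,
  and since its zeros have order at least \<open>d^n\<close>, the maximum principle excludes zeros on a disc of uniform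
  radius. There the root can be extracted, and \<open>s\<close> is a bounded holomorphic lift of \<open>\<phi>\<close>. The
  Schwarz lemma now shows that the Kobayashi distances of \<open>\<Omega>\<close> and of \<open>W\<close> dominate a multiple of the metric
  of projective space; in particular \<open>\<Omega>\<close> is hyperbolic.

  Given a Cauchy sequence in \<open>\<Omega>\<close>, all but finitely many terms are close to one of them, and this
  remains true in \<open>W\<close> after applying \<open>f^n\<close>. For large \<open>n\<close> the images therefore lie in a compact
  ball around \<open>p\<close> in \<open>W\<close>. A limit point in projective space is then mapped by \<open>f^n\<close> into \<open>W\<close>, hence lies in the
  Fatou set and in \<open>\<Omega>\<close>, because components are closed in the Fatou set.
\<close>

section \<open>Complex projective space\<close>

lemma hpoint_scale:
  assumes "c \<noteq> 0" "x \<noteq> 0"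
  shows "hpoint (c *s x) = hpoint x"
  using assms hpoint_eq_iff[of x "c *s x"] by (metis vector_mul_eq_0)

text \<open>Column \<open>i\<close> of the projection matrix is a multiple of \<open>x\<close>, so
  its quotients are the affine coordinates. Outside the chart both sides are 0 by the convention on
  division by 0. Since the metric makes \<open>line_projection\<close> an isometry, continuity
  passes to the charts.\<close>

lemma affine_coords_line_projection:
  "affine_coords i q = (\<chi> j. line_projection q $ j $ i / line_projection q $ i $ i)"
proof -
  obtain x where x: "x \<noteq> 0" "q = hpoint x" by (rule hpoint_cases)
  show ?thesis
    using x by (cases "x $ i = 0")
      (simp_all add: vec_eq_iff affine_coords_hpoint line_projection_hpoint)
qed

lemma in_chart_line_projection: "in_chart i q \<longleftrightarrow> line_projection q $ i $ i \<noteq> 0"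
proof -
  obtain x where x: "x \<noteq> 0" "q = hpoint x" by (rule hpoint_cases)
  then show ?thesis
    by (simp add: in_chart_hpoint line_projection_hpoint)
qed

lemma open_in_chart: "open {q. in_chart i q}"
  unfolding in_chart_line_projection
  by (intro open_Collect_neq continuous_intros continuous_on_line_projection)

lemma continuous_on_affine_coords: "continuous_on {q. in_chart i q} (affine_coords i)"
  unfolding affine_coords_line_projection in_chart_line_projection
  by (intro continuous_intros continuous_on_line_projection) auto

lemma affine_coords_self: "in_chart i q \<Longrightarrow> affine_coords i q $ i = 1"
  by (simp add: affine_coords_line_projection in_chart_line_projection)

lemma affine_coords_nonzero: "in_chart i q \<Longrightarrow> affine_coords i q \<noteq> 0"
  using affine_coords_self[of i q] by auto

lemma ex_in_chart: "\<exists>i. in_chart i q"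
proof -
  obtain x where x: "x \<noteq> 0" "q = hpoint x" by (rule hpoint_cases)
  then show ?thesis
    by (auto simp: in_chart_hpoint vec_eq_iff)
qed

lemma norm_scale: "norm (c *s (x :: complex^'n::finite)) = cmod c * norm x"
  by (simp add: norm_vec_def L2_set_def norm_mult power_mult_distrib sum_nonneg
      sum_distrib_left[symmetric] real_sqrt_mult)

lemma norm_le_sum_nth: "norm (x :: 'a::real_normed_vector^'n::finite) \<le> (\<Sum>i\<in>UNIV. norm (x $ i))"
  unfolding norm_vec_def by (rule L2_set_le_sum) simp

lemma norm_vec_le_card:
  assumes "\<And>i. norm ((x :: 'a::real_normed_vector^'n::finite) $ i) \<le> B"
  shows "norm x \<le> real CARD('n) * B"
proof -
  have "norm x \<le> (\<Sum>i\<in>UNIV. norm (x $ i))" by (rule norm_le_sum_nth)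
  also have "\<dots> \<le> (\<Sum>i\<in>(UNIV :: 'n set). B)" by (intro sum_mono assms)
  finally show ?thesis by simp
qed

text \<open>Scaling a representative to norm 1 exhibits projective space as a continuous image of
  the unit sphere.\<close>

lemma compact_cproj: "compact (UNIV :: 'n::finite cproj set)"
proof -
  have "compact (hpoint ` sphere (0 :: complex^'n) 1)"
    by (intro compact_continuous_image compact_sphere
        continuous_on_subset[OF continuous_on_hpoint]) auto
  moreover have "q \<in> hpoint ` sphere 0 1" for q :: "'n cproj"
  proof -
    obtain x where x: "x \<noteq> 0" "q = hpoint x" by (rule hpoint_cases)
    define c where "c = complex_of_real (inverse (norm x))"
    have "c \<noteq> 0" using x by (simp add: c_def)
    moreover have "norm (c *s x) = 1" using x by (simp add: norm_scale c_def norm_inverse)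
    ultimately show ?thesis
      using x hpoint_scale[of c x] by (metis dist_0_norm imageI mem_sphere)
  qed
  ultimately show ?thesis by (metis UNIV_eq_I)
qed

text \<open>Normalization to unit vectors is Lipschitz with constant \<open>2 / r\<close> at
  distance at least \<open>r\<close> from the origin, and the matrix entries are quadratic in the
  unit vector. The factor \<open>N\<close> occurs twice, for the rows and for the entries of a
  row.\<close>

lemma hpoint_lipschitz:
  assumes "r > 0"
  obtains L where "L > 0"
    "\<And>x y :: complex^'n::finite. r \<le> norm x \<Longrightarrow> r \<le> norm y \<Longrightarrow>
      dist (hpoint x) (hpoint y) \<le> L * norm (x - y)"
proof
  define N where "N = real CARD('n)"
  have N: "N > 0" by (simp add: N_def)
  show "N * (N * (4 / r)) > 0" using N assms by simp
  fix x y :: "complex^'n"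
  assume x: "r \<le> norm x" and y: "r \<le> norm y"
  have nz: "norm x > 0" "norm y > 0" "x \<noteq> 0" "y \<noteq> 0" using x y assms by auto
  define u where "u = x /\<^sub>R norm x"
  define v where "v = y /\<^sub>R norm y"
  have nu: "norm u = 1" "norm v = 1" using nz by (simp_all add: u_def v_def)
  have "u - v = (x - y) /\<^sub>R norm x + (inverse (norm x) - inverse (norm y)) *\<^sub>R y"
    by (simp add: u_def v_def algebra_simps)
  then have "norm (u - v) \<le> norm ((x - y) /\<^sub>R norm x) + norm ((inverse (norm x) - inverse (norm y)) *\<^sub>R y)"
    by (metis norm_triangle_ineq)
  also have "norm ((inverse (norm x) - inverse (norm y)) *\<^sub>R y) = \<bar>norm y - norm x\<bar> / norm x"
    using nz by (simp add: field_simps abs_mult[symmetric] abs_divide[symmetric])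
  also have "norm ((x - y) /\<^sub>R norm x) = norm (x - y) / norm x"
    by (simp add: divide_inverse)
  also have "\<bar>norm y - norm x\<bar> / norm x \<le> norm (x - y) / norm x"
    using nz norm_triangle_ineq3[of y x] by (simp add: divide_right_mono norm_minus_commute)
  also have "norm (x - y) / norm x + norm (x - y) / norm x \<le> norm (x - y) / r + norm (x - y) / r"
    using x assms nz by (intro add_mono divide_left_mono) auto
  finally have uv: "norm (u - v) \<le> 2 * norm (x - y) / r" by simp
  have lp: "line_projection (hpoint z) $ i $ j = (z /\<^sub>R norm z) $ i * cnj ((z /\<^sub>R norm z) $ j)"
    if "z \<noteq> 0" for z :: "complex^'n" and i j
    unfolding line_projection_hpoint[OF that] vector_scaleR_component
    by (simp add: scaleR_conv_of_real power2_eq_square divide_inverse mult_ac)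
  have ent: "norm ((line_projection (hpoint x) - line_projection (hpoint y)) $ i $ j) \<le> 4 / r * norm (x - y)" for i j
  proof -
    have "(line_projection (hpoint x) - line_projection (hpoint y)) $ i $ j
      = (u - v) $ i * cnj (u $ j) + v $ i * cnj ((u - v) $ j)"
      unfolding vector_minus_component lp[OF nz(3)] lp[OF nz(4)] u_def[symmetric] v_def[symmetric]
      by (simp add: algebra_simps)
    also have "norm \<dots> \<le> norm ((u - v) $ i) * norm (u $ j) + norm (v $ i) * norm ((u - v) $ j)"
      by (metis norm_triangle_ineq norm_mult complex_mod_cnj)
    also have "\<dots> \<le> norm (u - v) * 1 + 1 * norm (u - v)"
      using nu Finite_Cartesian_Product.norm_nth_le[of u j] Finite_Cartesian_Product.norm_nth_le[of v i]
        Finite_Cartesian_Product.norm_nth_le[of "u - v" i] Finite_Cartesian_Product.norm_nth_le[of "u - v" j]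
      by (intro add_mono mult_mono) auto
    finally show ?thesis using uv by simp
  qed
  have "norm (line_projection (hpoint x) - line_projection (hpoint y)) \<le> N * (N * (4 / r * norm (x - y)))"
    unfolding N_def by (intro norm_vec_le_card ent)
  then show "dist (hpoint x) (hpoint y) \<le> N * (N * (4 / r)) * norm (x - y)"
    by (simp add: dist_cproj_def dist_norm mult_ac)
qed

text \<open>By \<open>open_cproj_iff\<close> continuity can be tested in homogeneous coordinates,
  where \<open>F\<close> represents \<open>f\<close>.\<close>

lemma continuous_on_cproj:
  assumes F: "continuous_on {x. x \<noteq> 0} F" and nz: "\<And>x. x \<noteq> 0 \<Longrightarrow> F x \<noteq> 0"
    and f: "\<And>x. x \<noteq> 0 \<Longrightarrow> f (hpoint x) = hpoint (F x)"
  shows "continuous_on UNIV (f :: 'n::finite cproj \<Rightarrow> 'm::finite cproj)"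
proof -
  have "open (f -` U)" if "open U" for U
  proof -
    have o: "open {x::complex^'n. x \<noteq> 0}"
      by (simp add: open_Collect_neq)
    have "open (F -` {y. y \<noteq> 0 \<and> hpoint y \<in> U} \<inter> {x. x \<noteq> 0})"
      using F o that by (subst (asm) continuous_on_open_vimage) (auto simp: open_cproj_iff)
    also have "F -` {y. y \<noteq> 0 \<and> hpoint y \<in> U} \<inter> {x. x \<noteq> 0} = {x. x \<noteq> 0 \<and> hpoint x \<in> f -` U}"
      using nz f by auto
    finally show ?thesis by (simp add: open_cproj_iff)
  qed
  then show ?thesis by (simp add: continuous_on_open_vimage)
qed

text \<open>Projecting a fixed representative of \<open>q\<close> orthogonally onto nearby lines gives a continuous
  local choice of homogeneous coordinates.\<close>

lemma local_representatives:
  assumes "x \<noteq> (0 :: complex^'n::finite)" and "e > 0"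
  obtains \<eta> where "\<eta> > 0"
    "\<And>q. dist q (hpoint x) < \<eta> \<Longrightarrow> \<exists>y. y \<noteq> 0 \<and> hpoint y = q \<and> norm (y - x) < e"
proof -
  define h where "h = (\<lambda>q. line_projection q *v x)"
  have "continuous_on UNIV h"
    unfolding h_def matrix_vector_mult_def
    by (intro continuous_intros continuous_on_line_projection)
  moreover have hx: "h (hpoint x) = x"
    using assms by (simp add: h_def line_projection_self)
  ultimately have "\<exists>\<eta>>0. \<forall>q. dist q (hpoint x) < \<eta> \<longrightarrow> dist (h q) x < min e (norm x)"
    using assms unfolding continuous_on_iff
    by (metis UNIV_I min_less_iff_conj zero_less_norm_iff)
  then obtain \<eta> where \<eta>: "\<eta> > 0" "\<And>q. dist q (hpoint x) < \<eta> \<Longrightarrow> dist (h q) x < min e (norm x)"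
    by blast
  show thesis
  proof (rule that[OF \<eta>(1)])
    fix q assume q: "dist q (hpoint x) < \<eta>"
    obtain y where y: "y \<noteq> 0" "q = hpoint y" by (rule hpoint_cases)
    have c: "\<exists>c. h q = c *s y"
      unfolding h_def y(2) line_projection_mult[OF y(1)] by blast
    have d: "dist (h q) x < min e (norm x)" by (rule \<eta>(2)[OF q])
    have "h q \<noteq> 0" using d by auto
    then show "\<exists>y. y \<noteq> 0 \<and> hpoint y = q \<and> norm (y - x) < e"
      using c d y hpoint_eq_iff[of y "h q"] by (auto simp: dist_norm intro!: exI[of _ "h q"])
  qed
qed

lemma representatives_in_open:
  assumes "open M" "hpoint x \<in> M" "x \<noteq> (0 :: complex^'n::finite)"
  obtains \<epsilon> where "\<epsilon> > 0" "\<And>y. norm (y - x) < \<epsilon> \<Longrightarrow> y \<noteq> 0 \<and> hpoint y \<in> M"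
proof -
  have "open {y. y \<noteq> 0 \<and> hpoint y \<in> M}" using assms open_cproj_iff by blast
  then obtain \<epsilon> where "\<epsilon> > 0" "ball x \<epsilon> \<subseteq> {y. y \<noteq> 0 \<and> hpoint y \<in> M}"
    using assms open_contains_ball by (metis (mono_tags, lifting) mem_Collect_eq)
  then show thesis
    by (intro that[of \<epsilon>]) (auto simp: subset_eq dist_norm norm_minus_commute)
qed

text \<open>Projective space is locally connected: the image of a small ball of representatives is
  connected, hence lies in the component, and by \<open>local_representatives\<close> it contains a
  neighborhood.\<close>

lemma open_component_cproj:
  assumes "open S" "C \<in> components (S :: 'n::finite cproj set)"
  shows "open C"
proof (subst open_subopen, intro ballI)
  fix q assume q: "q \<in> C"
  obtain x where x: "x \<noteq> 0" "q = hpoint x" by (rule hpoint_cases)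
  have "hpoint x \<in> S" using assms(2) q x in_components_subset by blast
  then obtain \<epsilon> where \<epsilon>: "\<epsilon> > 0" "\<And>y. norm (y - x) < \<epsilon> \<Longrightarrow> y \<noteq> 0 \<and> hpoint y \<in> S"
    using representatives_in_open[OF assms(1) _ x(1)] by metis
  have b: "y \<in> ball x \<epsilon> \<Longrightarrow> y \<noteq> 0 \<and> hpoint y \<in> S" for y
    using \<epsilon>(2)[of y] by (auto simp: dist_norm norm_minus_commute)
  have "connected (hpoint ` ball x \<epsilon>)"
    using b by (intro connected_continuous_image continuous_on_subset[OF continuous_on_hpoint]
        connected_ball) blast
  moreover have "hpoint ` ball x \<epsilon> \<subseteq> S" using b by auto
  moreover have "C \<inter> hpoint ` ball x \<epsilon> \<noteq> {}" using q x \<epsilon>(1) by auto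
  ultimately have sub: "hpoint ` ball x \<epsilon> \<subseteq> C"
    using assms(2) components_maximal by blast
  obtain \<eta> where \<eta>: "\<eta> > 0"
    "\<And>q. dist q (hpoint x) < \<eta> \<Longrightarrow> \<exists>y. y \<noteq> 0 \<and> hpoint y = q \<and> norm (y - x) < \<epsilon>"
    using local_representatives[OF x(1) \<epsilon>(1)] by metis
  have "ball q \<eta> \<subseteq> hpoint ` ball x \<epsilon>"
  proof
    fix q' assume "q' \<in> ball q \<eta>"
    then obtain y where "hpoint y = q'" "norm (y - x) < \<epsilon>"
      using \<eta>(2)[of q'] x by (auto simp: dist_commute)
    then show "q' \<in> hpoint ` ball x \<epsilon>" by (auto simp: dist_norm norm_minus_commute)
  qed
  then show "\<exists>T. open T \<and> q \<in> T \<and> T \<subseteq> C"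
    using sub \<eta>(1) by (intro exI[of _ "ball q \<eta>"]) auto
qed

section \<open>The Kobayashi pseudodistance\<close>

lemma moebius_norm_lt_1:
  fixes a b :: complex
  assumes "norm a < 1" "norm b < 1"
  shows "norm ((a - b) / (1 - cnj a * b)) < 1"
  using Moebius_function_norm_lt_1[OF assms, of 0]
  by (simp add: Moebius_function_simple norm_divide norm_minus_commute)

lemma artanh_ge_self:
  fixes t :: real
  assumes "0 \<le> t" "t < 1"
  shows "t \<le> 2 * artanh t"
proof -
  have "2 * artanh t = ln (1 + t) - ln (1 - t)"
    using assms by (simp add: artanh_def ln_div)
  moreover have "ln (1 - t) \<le> - t"
    using assms ln_le_minus_one[of "1 - t"] by simp
  moreover have "0 \<le> ln (1 + t)" using assms by simp
  ultimately show ?thesis by simp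
qed

text \<open>The left side is the pseudohyperbolic distance, the quantity that the Schwarz lemma
  controls.\<close>

lemma poincare_dist_ge:
  assumes "a \<in> ball 0 1" "b \<in> ball 0 1"
  shows "cmod ((a - b) / (1 - cnj a * b)) \<le> poincare_dist a b"
  unfolding poincare_dist_def using assms
  by (intro artanh_ge_self moebius_norm_lt_1) auto

lemma poincare_dist_nonneg:
  "a \<in> ball 0 1 \<Longrightarrow> b \<in> ball 0 1 \<Longrightarrow> 0 \<le> poincare_dist a b"
  using poincare_dist_ge[of a b] norm_ge_zero order_trans by blast

lemma poincare_dist_commute: "poincare_dist a b = poincare_dist b a"
proof -
  have "cmod (1 - cnj a * b) = cmod (cnj (1 - cnj a * b))" by (simp only: complex_mod_cnj)
  also have "\<dots> = cmod (1 - cnj b * a)" by (simp add: mult.commute)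
  finally show ?thesis by (simp add: poincare_dist_def norm_divide norm_minus_commute)
qed

section \<open>Holomorphic discs in homogeneous coordinates\<close>

lemma holomorphic_on_local:
  assumes "\<And>z. z \<in> S \<Longrightarrow> \<exists>T. open T \<and> z \<in> T \<and> g holomorphic_on T"
  shows "g holomorphic_on S"
  using assms holomorphic_on_imp_differentiable_at field_differentiable_at_within
  unfolding holomorphic_on_def by metis

text \<open>Unlike affine coordinates, a nowhere vanishing holomorphic lift can be composed with
  polynomial maps without regard to charts; this gives \<open>local_lift_funpow\<close>.\<close>

definition local_lift :: "complex set \<Rightarrow> (complex \<Rightarrow> complex^'n::finite) \<Rightarrow> (complex \<Rightarrow> 'n cproj) \<Rightarrow> bool" where
  "local_lift T s \<phi> \<longleftrightarrow> open T \<and> (\<forall>k. (\<lambda>w. s w $ k) holomorphic_on T) \<and>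
     (\<forall>w\<in>T. s w \<noteq> 0 \<and> hpoint (s w) = \<phi> w)"

lemma continuous_on_local_lift:
  assumes "local_lift T s \<phi>"
  shows "continuous_on T s"
proof -
  have "continuous_on T (\<lambda>w. \<chi> k. s w $ k)"
    using assms by (intro continuous_on_vec_lambda holomorphic_on_imp_continuous_on)
      (auto simp: local_lift_def)
  then show ?thesis by simp
qed

lemma local_lift_chart:
  assumes "holomorphic_disc M \<phi>"
  shows "local_lift {z \<in> ball 0 1. in_chart j (\<phi> z)} (\<lambda>z. affine_coords j (\<phi> z)) \<phi>"
proof -
  have "open (ball 0 1 \<inter> \<phi> -` {q. in_chart j q})"
    using assms open_in_chart[of j] by (intro continuous_open_preimage) (auto simp: holomorphic_disc_def)
  also have "ball 0 1 \<inter> \<phi> -` {q. in_chart j q} = {z \<in> ball 0 1. in_chart j (\<phi> z)}" by auto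
  finally show ?thesis
    using assms
    by (auto simp: local_lift_def holomorphic_disc_def affine_coords_nonzero hpoint_affine_coords)
qed

text \<open>Affine coordinates are themselves a lift; conversely, they are quotients of the
  coordinates of any lift.\<close>

lemma holomorphic_disc_iff_local_lift:
  "holomorphic_disc M \<phi> \<longleftrightarrow>
     \<phi> ` ball 0 1 \<subseteq> M \<and> (\<forall>z\<in>ball 0 1. \<exists>T s. z \<in> T \<and> local_lift T s \<phi>)"
proof
  assume \<phi>: "holomorphic_disc M \<phi>"
  have "\<exists>T s. z \<in> T \<and> local_lift T s \<phi>" if z: "z \<in> ball 0 1" for z
  proof -
    obtain j where "in_chart j (\<phi> z)" using ex_in_chart by blast
    with z have "z \<in> {z \<in> ball 0 1. in_chart j (\<phi> z)}" by simp
    with local_lift_chart[OF \<phi>] show ?thesis by meson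
  qed
  then show "\<phi> ` ball 0 1 \<subseteq> M \<and> (\<forall>z\<in>ball 0 1. \<exists>T s. z \<in> T \<and> local_lift T s \<phi>)"
    using \<phi> unfolding holomorphic_disc_def by blast
next
  assume "\<phi> ` ball 0 1 \<subseteq> M \<and> (\<forall>z\<in>ball 0 1. \<exists>T s. z \<in> T \<and> local_lift T s \<phi>)"
  then have im: "\<phi> ` ball 0 1 \<subseteq> M" and lift: "\<forall>z\<in>ball 0 1. \<exists>T s. z \<in> T \<and> local_lift T s \<phi>"
    by blast+
  have "isCont \<phi> z" if z: "z \<in> ball 0 1" for z
  proof -
    obtain T s where T: "z \<in> T" "local_lift T s \<phi>" using lift z by blast
    have "continuous_on T (\<lambda>w. hpoint (s w))"
      using T by (intro continuous_on_compose2[OF continuous_on_hpoint continuous_on_local_lift])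
        (auto simp: local_lift_def)
    then have "continuous_on T \<phi>"
      using T by (auto simp: local_lift_def elim: continuous_on_eq)
    then show ?thesis
      using T by (simp add: local_lift_def continuous_on_eq_continuous_at)
  qed
  then have "continuous_on (ball 0 1) \<phi>" by (simp add: continuous_at_imp_continuous_on)
  moreover have "(\<lambda>z. affine_coords i (\<phi> z) $ j) holomorphic_on {z \<in> ball 0 1. in_chart i (\<phi> z)}" for i j
  proof (rule holomorphic_on_local)
    fix z assume z: "z \<in> {z \<in> ball 0 1. in_chart i (\<phi> z)}"
    then obtain T s where T: "z \<in> T" "local_lift T s \<phi>" using lift by blast
    \<comment> \<open>The part of \<open>T\<close> that is mapped into chart \<open>i\<close>, where
      division by coordinate \<open>i\<close> is allowed.\<close>
    define T' where "T' = T \<inter> (\<lambda>w. s w $ i) -` (- {0})"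
    have "open T'"
      unfolding T'_def using T
      by (intro continuous_open_preimage holomorphic_on_imp_continuous_on) (auto simp: local_lift_def)
    moreover have "s z \<noteq> 0" "in_chart i (hpoint (s z))"
      using T z by (simp_all add: local_lift_def)
    then have "z \<in> T'"
      using T by (simp add: T'_def in_chart_hpoint)
    moreover have "(\<lambda>w. s w $ j / s w $ i) holomorphic_on T'"
      using T by (intro holomorphic_intros)
        (auto simp: T'_def local_lift_def intro: holomorphic_on_subset)
    then have "(\<lambda>w. affine_coords i (\<phi> w) $ j) holomorphic_on T'"
    proof (rule holomorphic_transform)
      fix w assume "w \<in> T'"
      then have "s w \<noteq> 0" "\<phi> w = hpoint (s w)" using T by (auto simp: T'_def local_lift_def)
      then show "s w $ j / s w $ i = affine_coords i (\<phi> w) $ j" by (simp add: affine_coords_hpoint)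
    qed
    ultimately show "\<exists>T. open T \<and> z \<in> T \<and> (\<lambda>z. affine_coords i (\<phi> z) $ j) holomorphic_on T"
      by blast
  qed
  ultimately show "holomorphic_disc M \<phi>" using im by (simp add: holomorphic_disc_def)
qed

section \<open>Chains of discs and their infimum\<close>

lemma disc_chain_in: "disc_chain M x y s \<Longrightarrow> x \<in> M \<and> y \<in> M \<and> 0 \<le> s"
proof (induction rule: disc_chain.induct)
  case (step y s \<phi> a b)
  then show ?case
    using poincare_dist_nonneg[of a b] by (auto simp: holomorphic_disc_def)
qed auto

lemma disc_chain_trans:
  assumes "disc_chain M y z t" "disc_chain M x y s"
  shows "disc_chain M x z (s + t)"
  using assms
proof (induction arbitrary: s rule: disc_chain.induct)
  case (step z t \<phi> a b)
  then have "disc_chain M x z (s + t)" by blast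
  then have "disc_chain M x (\<phi> b) (s + t + poincare_dist a b)"
    using step disc_chain.step by blast
  then show ?case by (simp add: add.assoc)
qed auto

lemma disc_chain_disc:
  assumes "holomorphic_disc M \<phi>" "a \<in> ball 0 1" "b \<in> ball 0 1"
  shows "disc_chain M (\<phi> a) (\<phi> b) (poincare_dist a b)"
proof -
  have "disc_chain M (\<phi> a) (\<phi> a) 0"
    using assms by (intro disc_chain.refl) (auto simp: holomorphic_disc_def)
  from disc_chain.step[OF this assms HOL.refl] show ?thesis by simp
qed

lemma disc_chain_sym: "disc_chain M x y s \<Longrightarrow> disc_chain M y x s"
proof (induction rule: disc_chain.induct)
  case (step y s \<phi> a b)
  have "disc_chain M (\<phi> b) y (poincare_dist a b)"
    using disc_chain_disc[OF step(2,4,3)] step(5) by (simp add: poincare_dist_commute)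
  from disc_chain_trans[OF step(6) this] show ?case by (simp add: add.commute)
qed (auto intro: disc_chain.refl)

text \<open>Composing every disc with \<open>f\<close> keeps the parameters and hence the length;
  for the infima this is the distance-decreasing property.\<close>

lemma disc_chain_map:
  assumes "disc_chain M x y s"
    and "\<And>\<phi>. holomorphic_disc M \<phi> \<Longrightarrow> holomorphic_disc N (f \<circ> \<phi>)" "f ` M \<subseteq> N"
  shows "disc_chain N (f x) (f y) s"
  using assms(1)
proof (induction rule: disc_chain.induct)
  case refl
  then show ?case using assms by (auto intro: disc_chain.refl)
next
  case (step y s \<phi> a b)
  have "disc_chain N (f x) ((f \<circ> \<phi>) b) (s + poincare_dist a b)"
    using step.hyps step.IH assms(2)[OF step.hyps(2)]
    by (intro disc_chain.step[where y = "f y"]) (simp_all add: o_def)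
  then show ?case by simp
qed

lemma kobayashi_dist_le: "disc_chain M x y s \<Longrightarrow> kobayashi_dist M x y \<le> s"
  using disc_chain_in[of M x y] unfolding kobayashi_dist_def
  by (auto intro!: cInf_lower bdd_belowI[of _ 0])

text \<open>The chain of length \<open>s0\<close> guarantees that the infimum is taken over a
  nonempty set; \<open>Inf\<close> of the empty set of reals carries no information.\<close>

lemma kobayashi_dist_ge:
  assumes "disc_chain M x y s0" "\<And>s. disc_chain M x y s \<Longrightarrow> c \<le> s"
  shows "c \<le> kobayashi_dist M x y"
  using disc_chain_in[of M x y] assms unfolding kobayashi_dist_def
  by (auto intro!: cInf_greatest)

lemma kobayashi_dist_less_imp:
  assumes "disc_chain M x y s0" "kobayashi_dist M x y < e"
  obtains s where "disc_chain M x y s" "s < e"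
  using kobayashi_dist_ge[OF assms(1), of e] assms(2) by force

lemma kobayashi_dist_commute: "kobayashi_dist M x y = kobayashi_dist M y x"
proof -
  have "{s. disc_chain M x y s} = {s. disc_chain M y x s}" using disc_chain_sym by blast
  then show ?thesis by (simp add: kobayashi_dist_def)
qed

text \<open>A point close to \<open>hpoint x\<close> is reached by one disc, contained in a complex line through
  \<open>x\<close> in homogeneous coordinates.\<close>

lemma holomorphic_disc_line:
  assumes "\<And>z. z \<in> ball 0 1 \<Longrightarrow> x + z *s v \<noteq> 0 \<and> hpoint (x + z *s v) \<in> M"
  shows "holomorphic_disc M (\<lambda>z. hpoint (x + z *s v))"
proof -
  have "local_lift (ball 0 1) (\<lambda>z. x + z *s v) (\<lambda>z. hpoint (x + z *s v))"
    using assms by (auto simp: local_lift_def intro!: holomorphic_intros)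
  then show ?thesis
    using assms unfolding holomorphic_disc_iff_local_lift by (metis image_subsetI)
qed

lemma short_disc_chain:
  assumes "open M" "q \<in> M" "e > 0"
  obtains \<eta> where "\<eta> > 0" "\<And>q'. dist q' q < \<eta> \<Longrightarrow> \<exists>s<e. disc_chain M q q' s"
proof -
  obtain x where x: "x \<noteq> 0" "q = hpoint x" by (rule hpoint_cases)
  obtain \<epsilon> where \<epsilon>: "\<epsilon> > 0" "\<And>y. norm (y - x) < \<epsilon> \<Longrightarrow> y \<noteq> 0 \<and> hpoint y \<in> M"
    using representatives_in_open[OF assms(1) _ x(1)] assms x by metis
  have "((\<lambda>t. 2 * artanh t) \<longlongrightarrow> 2 * artanh 0) (at (0::real))"
    by (intro isContD continuous_intros) auto
  then have "eventually (\<lambda>t::real. 2 * artanh t < e) (at 0)"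
    using assms by (intro order_tendstoD) simp_all
  then obtain t0 :: real where t0: "t0 > 0" "\<And>t. t \<noteq> 0 \<Longrightarrow> \<bar>t\<bar> < t0 \<Longrightarrow> 2 * artanh t < e"
    unfolding eventually_at by (auto simp: dist_real_def)
  have t0': "2 * artanh t < e" if "\<bar>t\<bar> < t0" for t :: real
    using t0(2)[of t] that assms by (cases "t = 0") auto
  \<comment> \<open>The factor \<open>min 1 t0\<close> puts the parameter \<open>t\<close> defined
    below into the unit disc and makes its Poincare distance from 0 smaller than
    \<open>e\<close>.\<close>
  obtain \<eta> where \<eta>: "\<eta> > 0" "\<And>q'. dist q' (hpoint x) < \<eta> \<Longrightarrow>
      \<exists>y. y \<noteq> 0 \<and> hpoint y = q' \<and> norm (y - x) < min 1 t0 * \<epsilon>"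
    using local_representatives[OF x(1), of "min 1 t0 * \<epsilon>"] \<epsilon>(1) t0(1) by auto
  show thesis
  proof (rule that[OF \<eta>(1)])
    fix q' assume "dist q' q < \<eta>"
    then obtain y where y: "y \<noteq> 0" "hpoint y = q'" "norm (y - x) < min 1 t0 * \<epsilon>"
      using \<eta>(2) x by blast
    show "\<exists>s<e. disc_chain M q q' s"
    proof (cases "y = x")
      case True
      then show ?thesis
        using disc_chain.refl[OF assms(2)] assms(3) x y by auto
    next
      case False
      \<comment> \<open>\<open>v\<close> is the direction of \<open>y - x\<close> scaled to norm
        \<open>\<epsilon>\<close>, so the whole unit disc stays in the ball of admissible
        representatives; \<open>t\<close> is the parameter at which \<open>y\<close> is
        reached.\<close>
      define t where "t = norm (y - x) / \<epsilon>"
      define v where "v = complex_of_real (inverse t) *s (y - x)"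
      have "norm (y - x) < 1 * \<epsilon>" "norm (y - x) < t0 * \<epsilon>"
        using y(3) \<epsilon>(1) mult_right_mono[of "min 1 t0" 1 \<epsilon>] mult_right_mono[of "min 1 t0" t0 \<epsilon>]
        by linarith+
      then have t: "0 < t" "t < 1" "t < t0"
        using False \<epsilon>(1) by (simp_all add: t_def field_simps)
      have nv: "norm v = \<epsilon>"
        using t(1) \<epsilon>(1) False unfolding v_def norm_scale norm_of_real by (simp add: t_def)
      have "x + z *s v \<noteq> 0 \<and> hpoint (x + z *s v) \<in> M" if "z \<in> ball 0 1" for z
        using that nv \<epsilon>(1) by (intro \<epsilon>(2)) (simp add: norm_scale)
      then have "holomorphic_disc M (\<lambda>z. hpoint (x + z *s v))"
        by (rule holomorphic_disc_line)
      from disc_chain_disc[OF this, of 0 "of_real t"] t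
      have "disc_chain M (hpoint (x + 0 *s v)) (hpoint (x + of_real t *s v)) (poincare_dist 0 (of_real t))"
        by simp
      moreover have "x + of_real t *s v = y"
        using t by (simp add: v_def vector_smult_assoc flip: of_real_mult)
      moreover have "poincare_dist 0 (of_real t) = 2 * artanh t"
        using t by (simp add: poincare_dist_def)
      ultimately show ?thesis
        using t0'[of t] t x y by auto
    qed
  qed
qed

text \<open>Being joined by a chain is an equivalence relation, and \<open>short_disc_chain\<close>
  makes its classes open, so a connected set has only one.\<close>

lemma disc_chain_exists:
  assumes "open M" "connected M" "x \<in> M" "y \<in> M"
  shows "\<exists>s. disc_chain M x y s"
proof (rule connected_equivalence_relation[OF assms(2-4)])
  fix a assume a: "a \<in> M"
  obtain \<eta> where \<eta>: "\<eta> > 0" "\<And>q'. dist q' a < \<eta> \<Longrightarrow> \<exists>s<1. disc_chain M a q' s"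
    using short_disc_chain[OF assms(1) a, of 1] by auto
  show "\<exists>T. openin (top_of_set M) T \<and> a \<in> T \<and> (\<forall>x\<in>T. \<exists>s. disc_chain M a x s)"
    using \<eta> a by (intro exI[of _ "M \<inter> ball a \<eta>"]) (fastforce simp: dist_commute)
qed (blast intro: disc_chain_sym disc_chain_trans)+

lemma kobayashi_dist_nonneg:
  assumes "open M" "connected M"
  shows "0 \<le> kobayashi_dist M x y"
proof (cases "x \<in> M \<and> y \<in> M")
  case True
  then obtain s where "disc_chain M x y s" using disc_chain_exists assms by blast
  then show ?thesis using disc_chain_in kobayashi_dist_ge by metis
qed (auto simp: kobayashi_dist_def)

lemma kobayashi_dist_triangle:
  assumes "open M" "connected M" "x \<in> M" "y \<in> M" "z \<in> M"
  shows "kobayashi_dist M x z \<le> kobayashi_dist M x y + kobayashi_dist M y z"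
proof -
  obtain s0 t0 where 0: "disc_chain M x y s0" "disc_chain M y z t0"
    using disc_chain_exists assms by metis
  \<comment> \<open>A chain from \<open>y\<close> to \<open>z\<close> is held fixed while the
    infimum over chains from \<open>x\<close> to \<open>y\<close> is taken; afterwards the former
    varies.\<close>
  have "kobayashi_dist M x z - t \<le> kobayashi_dist M x y" if "disc_chain M y z t" for t
    using kobayashi_dist_le[OF disc_chain_trans[OF that]]
    by (intro kobayashi_dist_ge[OF 0(1)]) (simp add: diff_le_eq)
  then have "kobayashi_dist M x z - kobayashi_dist M x y \<le> kobayashi_dist M y z"
    by (intro kobayashi_dist_ge[OF 0(2)]) (simp add: algebra_simps)
  then show ?thesis by simp
qed

lemma kobayashi_hyperbolic_if_dist_le:
  assumes "open M" "connected M"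
    and "\<And>x y. x \<in> M \<Longrightarrow> y \<in> M \<Longrightarrow> dist x y \<le> C * kobayashi_dist M x y"
  shows "kobayashi_hyperbolic M"
  unfolding kobayashi_hyperbolic_def
proof (unfold_locales)
  fix x y z
  show "0 \<le> kobayashi_dist M x y" by (rule kobayashi_dist_nonneg[OF assms(1,2)])
  show "kobayashi_dist M x y = kobayashi_dist M y x" by (rule kobayashi_dist_commute)
  assume x: "x \<in> M" and y: "y \<in> M"
  show "kobayashi_dist M x y = 0 \<longleftrightarrow> x = y"
  proof
    assume "kobayashi_dist M x y = 0"
    then show "x = y" using assms(3)[OF x y] by simp
  next
    assume "x = y"
    then have "kobayashi_dist M x y \<le> 0"
      using kobayashi_dist_le[OF disc_chain.refl[OF x]] by simp
    then show "kobayashi_dist M x y = 0"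
      using kobayashi_dist_nonneg[OF assms(1,2), of x y] by simp
  qed
  assume "z \<in> M"
  then show "kobayashi_dist M x z \<le> kobayashi_dist M x y + kobayashi_dist M y z"
    using kobayashi_dist_triangle[OF assms(1,2)] x y by blast
qed

section \<open>Comparison with the metric of projective space\<close>

lemma holomorphic_disc_compose:
  assumes "holomorphic_disc M \<phi>" "\<mu> holomorphic_on ball 0 1" "\<mu> ` ball 0 1 \<subseteq> ball 0 1"
  shows "holomorphic_disc M (\<phi> \<circ> \<mu>)"
  unfolding holomorphic_disc_def
proof (intro conjI allI)
  show "(\<phi> \<circ> \<mu>) ` ball 0 1 \<subseteq> M"
    using assms by (auto simp: holomorphic_disc_def image_subset_iff)
  show "continuous_on (ball 0 1) (\<phi> \<circ> \<mu>)"
    using assms by (intro continuous_on_compose holomorphic_on_imp_continuous_on)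
      (auto simp: holomorphic_disc_def elim: continuous_on_subset)
  fix i j
  have "(\<lambda>z. affine_coords i (\<phi> z) $ j) \<circ> \<mu> holomorphic_on {z \<in> ball 0 1. in_chart i ((\<phi> \<circ> \<mu>) z)}"
  proof (rule holomorphic_on_compose_gen)
    show "(\<lambda>z. affine_coords i (\<phi> z) $ j) holomorphic_on {z \<in> ball 0 1. in_chart i (\<phi> z)}"
      using assms(1) by (auto simp: holomorphic_disc_def)
    show "\<mu> holomorphic_on {z \<in> ball 0 1. in_chart i ((\<phi> \<circ> \<mu>) z)}"
      using assms(2) by (rule holomorphic_on_subset) auto
    show "\<mu> ` {z \<in> ball 0 1. in_chart i ((\<phi> \<circ> \<mu>) z)} \<subseteq> {z \<in> ball 0 1. in_chart i (\<phi> z)}"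
      using assms(3) by (auto simp: image_subset_iff)
  qed
  then show "(\<lambda>z. affine_coords i ((\<phi> \<circ> \<mu>) z) $ j) holomorphic_on {z \<in> ball 0 1. in_chart i ((\<phi> \<circ> \<mu>) z)}"
    by (simp add: o_def)
qed

text \<open>By homogeneity of the disc it suffices to compare distances from the centre.\<close>

lemma dist_le_kobayashi_dist:
  assumes "open M" "connected M" "C \<ge> 0"
    and disc: "\<And>\<phi> z. holomorphic_disc M \<phi> \<Longrightarrow> z \<in> ball 0 1 \<Longrightarrow> dist (\<phi> 0) (\<phi> z) \<le> C * norm z"
    and "x \<in> M" "y \<in> M"
  shows "dist x y \<le> C * kobayashi_dist M x y"
proof -
  have one: "dist (\<phi> a) (\<phi> b) \<le> C * poincare_dist a b"
    if \<phi>: "holomorphic_disc M \<phi>" and a: "a \<in> ball 0 1" and b: "b \<in> ball 0 1" for \<phi> a b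
  proof -
    \<comment> \<open>The disc automorphism with \<open>\<mu> 0 = a\<close> and
      \<open>\<mu> z = b\<close>, which moves the first parameter to the centre.\<close>
    define \<mu> where "\<mu> = Moebius_function 0 (-a)"
    define z where "z = Moebius_function 0 a b"
    have "\<mu> holomorphic_on ball 0 1"
      unfolding \<mu>_def by (rule Moebius_function_holomorphic) (use a in simp)
    moreover have "\<mu> ` ball 0 1 \<subseteq> ball 0 1"
      using Moebius_function_norm_lt_1[of "-a" _ 0] a by (simp add: \<mu>_def image_subset_iff)
    ultimately have d: "holomorphic_disc M (\<phi> \<circ> \<mu>)" by (rule holomorphic_disc_compose[OF \<phi>])
    have z: "z \<in> ball 0 1"
      using a b Moebius_function_norm_lt_1[of a b 0] by (simp add: z_def)
    have "\<mu> 0 = a" by (simp add: \<mu>_def Moebius_function_of_zero)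
    moreover have "\<mu> z = b"
      using a b by (simp add: \<mu>_def z_def Moebius_function_compose)
    ultimately have "dist (\<phi> a) (\<phi> b) \<le> C * norm z"
      using disc[OF d z] by simp
    also have "norm z \<le> poincare_dist a b"
      using poincare_dist_ge[OF a b] by (simp add: z_def Moebius_function_simple norm_divide norm_minus_commute)
    finally show ?thesis using assms(3) by (simp add: mult_left_mono)
  qed
  have chain: "dist x y \<le> C * s" if "disc_chain M x y s" for s
    using that
  proof (induction rule: disc_chain.induct)
    case (step y s \<phi> a b)
    then show ?case
      using one[of \<phi> a b] dist_triangle[of x "\<phi> b" y] by (auto simp: algebra_simps)
  qed auto
  obtain s0 where s0: "disc_chain M x y s0" using disc_chain_exists assms by blast
  show ?thesis
  \<comment> \<open>Passing to the infimum divides by \<open>C\<close>; for \<open>C = 0\<close> a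
    single chain already gives distance 0.\<close>
  proof (cases "C = 0")
    case True
    then show ?thesis using chain[OF s0] by simp
  next
    case False
    have "dist x y / C \<le> kobayashi_dist M x y"
      using chain False assms(3) by (intro kobayashi_dist_ge[OF s0]) (simp add: field_simps)
    then show ?thesis using False assms(3) by (simp add: field_simps)
  qed
qed

section \<open>Bounds for holomorphic functions on discs\<close>

lemma bounded_holomorphic_lipschitz:
  assumes "g holomorphic_on ball 0 \<delta>" "\<And>z. z \<in> ball 0 \<delta> \<Longrightarrow> cmod (g z) \<le> R"
    and "R > 0" "\<delta> > 0" "z \<in> ball 0 \<delta>"
  shows "cmod (g z - g 0) \<le> 3 * R / \<delta> * cmod z"
proof -
  \<comment> \<open>The difference has modulus at most \<open>2 * R\<close>; dividing by
    \<open>3 * R\<close> gives the strict bound by 1 that the Schwarz lemma asks for.\<close>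
  define h where "h = (\<lambda>w. (g (of_real \<delta> * w) - g 0) / of_real (3 * R))"
  have sub: "(\<lambda>w::complex. of_real \<delta> * w) ` ball 0 1 \<subseteq> ball 0 \<delta>"
    using assms by (auto simp: norm_mult)
  have "(g \<circ> (\<lambda>w. of_real \<delta> * w)) holomorphic_on ball 0 1"
    by (rule holomorphic_on_compose_gen[OF _ assms(1) sub]) (intro holomorphic_intros)
  then have "h holomorphic_on ball 0 1"
    unfolding h_def o_def using assms by (intro holomorphic_intros) auto
  moreover have "h 0 = 0" by (simp add: h_def)
  moreover have "norm (h w) < 1" if "norm w < 1" for w
  proof -
    have "of_real \<delta> * w \<in> ball 0 \<delta>" using that assms(4) by (simp add: norm_mult)
    then have "cmod (g (of_real \<delta> * w)) \<le> R" "cmod (g 0) \<le> R" using assms by auto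
    then have "cmod (g (of_real \<delta> * w) - g 0) < 3 * R"
      using assms norm_triangle_ineq4[of "g (of_real \<delta> * w)" "g 0"] by linarith
    then show ?thesis using assms by (simp add: h_def norm_divide norm_mult)
  qed
  moreover have "norm (z / of_real \<delta>) < 1" using assms by (simp add: norm_divide)
  ultimately have "norm (h (z / of_real \<delta>)) \<le> norm (z / of_real \<delta>)" by (rule Schwarz_Lemma(1))
  then show ?thesis using assms by (simp add: h_def norm_divide norm_mult field_simps)
qed

text \<open>The difference quotient tends to the derivative. The power of this estimate later
  supplies the order of vanishing required by \<open>high_order_zero_bound\<close>.\<close>

lemma holomorphic_zero_linear_bound:
  assumes "g holomorphic_on T" "open T" "\<epsilon> \<in> T" "g \<epsilon> = 0"
  obtains K where "K > 0" "eventually (\<lambda>z. cmod (g z) \<le> K * cmod (z - \<epsilon>)) (at \<epsilon>)"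
proof -
  have "(g has_field_derivative deriv g \<epsilon>) (at \<epsilon>)"
    using assms holomorphic_derivI by blast
  then have "((\<lambda>z. cmod ((g z - g \<epsilon>) / (z - \<epsilon>))) \<longlongrightarrow> cmod (deriv g \<epsilon>)) (at \<epsilon>)"
    unfolding has_field_derivative_iff by (rule tendsto_norm)
  then have "eventually (\<lambda>z. cmod ((g z - g \<epsilon>) / (z - \<epsilon>)) < cmod (deriv g \<epsilon>) + 1) (at \<epsilon>)"
    by (rule order_tendstoD) simp
  then have "eventually (\<lambda>z. cmod (g z) \<le> (cmod (deriv g \<epsilon>) + 1) * cmod (z - \<epsilon>)) (at \<epsilon>)"
    using eventually_at_ball'[of 1 \<epsilon> UNIV, OF zero_less_one]
  proof eventually_elim
    case (elim z)
    then have "cmod (z - \<epsilon>) > 0" by auto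
    with elim assms show ?case by (simp add: norm_divide field_simps)
  qed
  then show thesis by (rule that[rotated]) (simp add: add_nonneg_pos)
qed

text \<open>The maximum principle for the quotient by the power of \<open>z - \<epsilon>\<close>.\<close>

lemma high_order_zero_bound:
  assumes "E holomorphic_on U" "open U" "cball 0 \<rho> \<subseteq> U"
    and bd: "\<And>z. z \<in> cball 0 \<rho> \<Longrightarrow> cmod (E z) \<le> B ^ D" and "B \<ge> 0"
    and "cmod \<epsilon> < \<rho>" "E \<epsilon> = 0"
    and zero: "eventually (\<lambda>z. cmod (E z) \<le> K * cmod (z - \<epsilon>) ^ D) (at \<epsilon>)"
  shows "cmod (E 0) * (\<rho> - cmod \<epsilon>) ^ D \<le> (B * cmod \<epsilon>) ^ D"
proof (cases "\<epsilon> = 0")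
  case True
  then show ?thesis using assms by simp
next
  case False
  \<comment> \<open>By \<open>zero\<close> this quotient is bounded near \<open>\<epsilon>\<close>,
    so the singularity is removable and the maximum principle applies to the extension.\<close>
  define q where "q = (\<lambda>z. E z / (z - \<epsilon>) ^ D)"
  have \<epsilon>U: "\<epsilon> \<in> U" using assms by auto
  have "q holomorphic_on U - {\<epsilon>}"
    unfolding q_def using assms(1)
    by (intro holomorphic_intros) (auto intro: holomorphic_on_subset)
  moreover have "eventually (\<lambda>z. cmod (q z) \<le> K) (at \<epsilon>)"
    using zero eventually_at_ball'[of 1 \<epsilon> UNIV, OF zero_less_one]
  proof eventually_elim
    case (elim z)
    then have "cmod (z - \<epsilon>) ^ D > 0" by auto
    with elim show ?case by (simp add: q_def norm_divide norm_power field_simps)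
  qed
  ultimately obtain g where g: "g holomorphic_on U" "\<And>z. z \<in> U - {\<epsilon>} \<Longrightarrow> g z = q z"
    using holomorphic_on_extend_bounded[of q U \<epsilon>] \<epsilon>U assms(2) by (auto simp: interior_open)
  have \<rho>: "\<rho> > 0" using assms(6) norm_ge_zero[of \<epsilon>] by linarith
  have "cmod (g 0) \<le> B ^ D / (\<rho> - cmod \<epsilon>) ^ D"
  proof (rule maximum_modulus_frontier[where S = "ball 0 \<rho>" and f = g])
    show "g holomorphic_on interior (ball 0 \<rho>)"
      using g(1) assms(3) ball_subset_cball by (auto elim!: holomorphic_on_subset)
    show "continuous_on (closure (ball 0 \<rho>)) g"
      using g(1) assms(3) \<rho> by (auto intro: holomorphic_on_imp_continuous_on holomorphic_on_subset)
    fix z :: complex assume "z \<in> frontier (ball 0 \<rho>)"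
    then have z: "cmod z = \<rho>" using \<rho> by simp
    have le: "\<rho> - cmod \<epsilon> \<le> cmod (z - \<epsilon>)" using norm_triangle_ineq2[of z \<epsilon>] z by simp
    have "g z = q z" using z assms by (intro g(2)) auto
    moreover have "cmod (E z) / cmod (z - \<epsilon>) ^ D \<le> B ^ D / (\<rho> - cmod \<epsilon>) ^ D"
      using z assms le by (intro frac_le power_mono bd) auto
    ultimately show "cmod (g z) \<le> B ^ D / (\<rho> - cmod \<epsilon>) ^ D"
      by (simp add: q_def norm_divide norm_power)
  qed (use \<rho> in auto)
  moreover have "g 0 = q 0" using False \<rho> assms by (intro g(2)) auto
  ultimately have "cmod (E 0) / cmod \<epsilon> ^ D \<le> B ^ D / (\<rho> - cmod \<epsilon>) ^ D"
    by (simp add: q_def norm_divide norm_power)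
  then show ?thesis
    using False assms(6) by (simp add: field_simps power_mult_distrib)
qed

section \<open>Homogeneous lifts\<close>

lemma homogeneous_polynomial_scale:
  assumes "homogeneous_polynomial d P"
  shows "P (c *s x) = c ^ d * P x"
proof -
  obtain a where P: "\<And>x. P x = (\<Sum>\<alpha> | (\<Sum>i\<in>UNIV. \<alpha> i) = d. a \<alpha> * (\<Prod>i\<in>UNIV. x $ i ^ \<alpha> i))"
    using assms by (auto simp: homogeneous_polynomial_def)
  show ?thesis
    unfolding P sum_distrib_left
    by (rule sum.cong) (auto simp: power_mult_distrib prod.distrib power_sum)
qed

lemma holomorphic_on_homogeneous_polynomial:
  assumes "homogeneous_polynomial d P" "\<And>k. (\<lambda>w. s w $ k) holomorphic_on T"
  shows "(\<lambda>w. P (s w)) holomorphic_on T"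
  using assms by (auto simp: homogeneous_polynomial_def intro!: holomorphic_intros)

lemma continuous_on_homogeneous_polynomial:
  assumes "homogeneous_polynomial d P"
  shows "continuous_on S P"
proof -
  obtain a where P: "\<And>x. P x = (\<Sum>\<alpha> | (\<Sum>i\<in>UNIV. \<alpha> i) = d. a \<alpha> * (\<Prod>i\<in>UNIV. x $ i ^ \<alpha> i))"
    using assms by (auto simp: homogeneous_polynomial_def)
  show ?thesis
    unfolding P by (intro continuous_intros)
qed

locale homogeneous_lift =
  fixes d :: nat and F :: "complex^'n::finite \<Rightarrow> complex^'n" and f :: "'n cproj \<Rightarrow> 'n cproj"
  assumes homogeneous: "\<And>i. homogeneous_polynomial d (\<lambda>x. F x $ i)"
    and F_eq_0: "\<And>x. F x = 0 \<longleftrightarrow> x = 0"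
    and F_lift: "\<And>x. x \<noteq> 0 \<Longrightarrow> f (hpoint x) = hpoint (F x)"
    and degree: "2 \<le> d"
begin

lemma F_scale: "F (c *s x) = c ^ d *s F x"
  using homogeneous_polynomial_scale[OF homogeneous] by (simp add: vec_eq_iff)

lemma funpow_F_scale: "(F ^^ n) (c *s x) = c ^ (d ^ n) *s (F ^^ n) x"
  by (induction n) (simp_all add: F_scale power_mult[symmetric] mult.commute)

lemma funpow_F_eq_0: "(F ^^ n) x = 0 \<longleftrightarrow> x = 0"
  by (induction n) (simp_all add: F_eq_0)

lemma funpow_F_lift: "x \<noteq> 0 \<Longrightarrow> (f ^^ n) (hpoint x) = hpoint ((F ^^ n) x)"
  by (induction n) (simp_all add: F_lift funpow_F_eq_0)

lemma continuous_on_F: "continuous_on S F"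
proof -
  have "continuous_on S (\<lambda>x. \<chi> i. F x $ i)"
    by (intro continuous_on_vec_lambda continuous_on_homogeneous_polynomial[OF homogeneous])
  then show ?thesis by simp
qed

lemma continuous_on_f: "continuous_on S f"
  by (rule continuous_on_subset[OF continuous_on_cproj[of F f]])
    (auto simp: continuous_on_F F_eq_0 F_lift)

lemma continuous_on_funpow_f: "continuous_on S (f ^^ n)"
proof (induction n)
  case (Suc n)
  then show ?case
    using continuous_on_compose2[OF continuous_on_f[of UNIV]] by (simp add: o_def)
qed (simp add: continuous_on_id')

lemma local_lift_funpow: "local_lift T s \<phi> \<Longrightarrow> local_lift T (\<lambda>w. (F ^^ n) (s w)) (\<lambda>w. (f ^^ n) (\<phi> w))"
proof (induction n)
  case (Suc n)
  then have "local_lift T (\<lambda>w. (F ^^ n) (s w)) (\<lambda>w. (f ^^ n) (\<phi> w))" by blast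
  then show ?case
    by (auto simp: local_lift_def F_eq_0 F_lift[symmetric]
        intro!: holomorphic_on_homogeneous_polynomial[OF homogeneous])
qed simp

lemma holomorphic_disc_funpow:
  assumes "holomorphic_disc M \<phi>" "(f ^^ n) ` M \<subseteq> N"
  shows "holomorphic_disc N (f ^^ n \<circ> \<phi>)"
  unfolding holomorphic_disc_iff_local_lift
proof (intro conjI ballI)
  show "(f ^^ n \<circ> \<phi>) ` ball 0 1 \<subseteq> N"
    using assms unfolding holomorphic_disc_def by auto
  fix z :: complex assume "z \<in> ball 0 1"
  then obtain T s where "z \<in> T" "local_lift T s \<phi>"
    using assms(1) unfolding holomorphic_disc_iff_local_lift by meson
  then show "\<exists>T s. z \<in> T \<and> local_lift T s (f ^^ n \<circ> \<phi>)"
    using local_lift_funpow unfolding o_def by meson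
qed

text \<open>On the unit sphere \<open>F\<close> is continuous without zeros, so compactness gives
  both bounds there; homogeneity extends them.\<close>

lemma F_growth:
  obtains A where "A > 0" "\<And>x. norm (F x) \<le> A * norm x ^ d" "\<And>x. norm x ^ d \<le> A * norm (F x)"
proof -
  have "compact (F ` sphere 0 1)"
    by (intro compact_continuous_image continuous_on_F compact_sphere)
  then obtain A1 where A1: "A1 > 0" "\<And>x. norm x = 1 \<Longrightarrow> norm (F x) \<le> A1"
    using compact_imp_bounded bounded_pos by (metis (no_types, lifting) dist_0_norm imageI mem_sphere)
  have "compact ((\<lambda>x. inverse (norm (F x))) ` sphere 0 1)"
    by (intro compact_continuous_image continuous_intros continuous_on_F compact_sphere)
      (auto simp: F_eq_0)
  then obtain A2 where "A2 > 0" "\<And>x. norm x = 1 \<Longrightarrow> norm (inverse (norm (F x))) \<le> A2"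
    using compact_imp_bounded bounded_pos by (metis (no_types, lifting) dist_0_norm imageI mem_sphere)
  then have A2: "A2 > 0" "\<And>x. norm x = 1 \<Longrightarrow> inverse (norm (F x)) \<le> A2" by simp_all
  define A where "A = max A1 A2"
  have *: "norm (F x) \<le> A * norm x ^ d \<and> norm x ^ d \<le> A * norm (F x)" if x: "x \<noteq> 0" for x
  proof -
    define u where "u = complex_of_real (inverse (norm x)) *s x"
    have u: "norm u = 1" using x by (simp add: u_def norm_scale norm_inverse)
    have "complex_of_real (norm x) * complex_of_real (inverse (norm x)) = 1"
      using x by simp
    then have xu: "x = complex_of_real (norm x) *s u"
      by (metis u_def vector_smult_assoc vector_smult_lid)
    have F: "norm (F x) = norm x ^ d * norm (F u)"
      using arg_cong[OF xu, of "\<lambda>y. norm (F y)"]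
      by (simp only: F_scale norm_scale norm_power norm_of_real abs_norm_cancel)
    have "u \<noteq> 0" using u by auto
    then have pos: "norm (F u) > 0" by (simp add: F_eq_0)
    have A: "inverse (norm (F u)) \<le> A" "norm (F u) \<le> A"
      using A1(2)[OF u] A2(2)[OF u] by (auto simp: A_def)
    have "inverse (norm (F u)) * norm (F u) \<le> A * norm (F u)"
      by (intro mult_right_mono A) simp
    with pos have "1 \<le> A * norm (F u)" by simp
    then have "norm x ^ d * 1 \<le> norm x ^ d * (A * norm (F u))"
      by (intro mult_left_mono) auto
    then show ?thesis
      using mult_left_mono[OF A(2), of "norm x ^ d"] by (simp add: F mult_ac)
  qed
  show thesis
  proof (rule that[of A])
    show "A > 0" using A1 by (simp add: A_def)
    have "F 0 = 0" by (simp add: F_eq_0)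
    moreover have "(0::real) ^ d = 0" using degree by (intro zero_power) simp
    ultimately have **: "norm (F x) \<le> A * norm x ^ d \<and> norm x ^ d \<le> A * norm (F x)" for x
      using *[of x] by (cases "x = 0") (simp_all only: norm_zero mult_zero_right order_refl simp_thms)
    show "norm (F x) \<le> A * norm x ^ d" "norm x ^ d \<le> A * norm (F x)" for x
      using **[of x] by simp_all
  qed
qed

text \<open>Points of small norm are attracted to the origin and points of large norm escape, so a bound
  on a late iterate confines the starting point, independently of the number of iterations.\<close>

lemma funpow_F_confined:
  obtains r R where "r > 0" "R > 0"
    "\<And>n x. 1 \<le> norm ((F ^^ n) x) \<Longrightarrow> r \<le> norm x"
    "\<And>n x. norm ((F ^^ n) x) \<le> C \<Longrightarrow> norm x \<le> R"
proof -
  obtain A where A: "A > 0" "\<And>x. norm (F x) \<le> A * norm x ^ d" "\<And>x. norm x ^ d \<le> A * norm (F x)"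
    using F_growth by metis
  \<comment> \<open>With \<open>d = e + 2\<close> two linear factors split off
    \<open>norm y ^ d\<close>: one absorbs the constant \<open>A\<close>, the other is compared with
    \<open>norm y\<close>.\<close>
  obtain e where e: "d = Suc (Suc e)" using degree by (metis Suc_le_D numeral_2_eq_2 Suc_le_mono)
  \<comment> \<open>For \<open>norm y < r\<close> both \<open>norm y \<le> 1\<close> and
    \<open>A * norm y \<le> 1\<close> hold, hence \<open>norm (F y) \<le> norm y\<close>. Since
    \<open>r < 1\<close>, such a point never reaches norm 1.\<close>
  define r where "r = min (1/2) (1/A)"
  \<comment> \<open>From norm \<open>R\<close> on, \<open>norm y\<close> is at least 1 and at least
    \<open>A\<close>, so \<open>F\<close> does not decrease it; the term \<open>C + 1\<close> keeps
    the orbit outside the ball of radius \<open>C\<close>.\<close>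
  define R where "R = max (max 1 A) (C + 1)"
  have small: "norm ((F ^^ n) x) \<le> norm x" if x: "norm x < r" for n x
  proof (induction n)
    case (Suc n)
    define y where "y = (F ^^ n) x"
    have y: "norm y \<le> norm x" using Suc by (simp add: y_def)
    have "norm y ^ e \<le> 1" using x y by (intro power_le_one) (auto simp: r_def)
    moreover have "A * norm y \<le> 1"
      using x y A(1) by (simp add: r_def field_simps) (meson mult_left_mono less_imp_le order_trans)
    ultimately have "(A * norm y) * norm y ^ e \<le> 1 * 1"
      using A(1) by (intro mult_mono) auto
    then have "(A * norm y * norm y ^ e) * norm y \<le> 1 * norm y"
      by (intro mult_right_mono) auto
    then have "norm (F y) \<le> norm y"
      using A(2)[of y] by (simp add: e mult_ac)
    then show ?case using y by (simp add: y_def)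
  qed simp
  have large: "norm x \<le> norm ((F ^^ n) x)" if x: "R \<le> norm x" for n x
  proof (induction n)
    case (Suc n)
    define y where "y = (F ^^ n) x"
    have y: "norm x \<le> norm y" using Suc by (simp add: y_def)
    then have y': "1 \<le> norm y" "A \<le> norm y" using x by (auto simp: R_def)
    have "A * 1 \<le> norm y * norm y ^ e"
      using y' A(1) by (intro mult_mono one_le_power) auto
    then have "A * norm y \<le> norm y * norm y ^ e * norm y"
      by (intro mult_right_mono) auto
    also have "\<dots> \<le> A * norm (F y)"
      using A(3)[of y] by (simp add: e mult_ac)
    finally have "norm y \<le> norm (F y)" using A(1) by simp
    then show ?case using y by (simp add: y_def)
  qed simp
  show thesis
  proof (rule that[of r R])
    show "r > 0" "R > 0" using A(1) by (auto simp: r_def R_def)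
    show "r \<le> norm x" if "1 \<le> norm ((F ^^ n) x)" for n x
      using small[of x n] that by (fastforce simp: r_def)
    show "norm x \<le> R" if "norm ((F ^^ n) x) \<le> C" for n x
      using large[of x n] that by (fastforce simp: R_def)
  qed
qed


section \<open>Representatives normalized after \<open>n\<close> iterations\<close>

lemma normalized_representative:
  assumes "in_chart i ((f ^^ n) q)"
  obtains s where "s \<noteq> 0" "hpoint s = q" "(F ^^ n) s = affine_coords i ((f ^^ n) q)"
proof -
  obtain x where x: "x \<noteq> 0" "q = hpoint x" by (rule hpoint_cases)
  define w where "w = (F ^^ n) x $ i"
  have Fx: "(F ^^ n) x \<noteq> 0" using x by (simp add: funpow_F_eq_0)
  have w: "w \<noteq> 0"
    using assms x Fx by (simp add: w_def funpow_F_lift in_chart_hpoint)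
  \<comment> \<open>\<open>F ^^ n\<close> is homogeneous of degree \<open>d ^ n\<close>, so making
    coordinate \<open>i\<close> equal to 1 takes a root of that order of
    \<open>inverse w\<close>.\<close>
  define c where "c = exp (- Ln w / of_nat (d ^ n))"
  have "d ^ n > 0" using degree by simp
  then have "c ^ (d ^ n) = exp (- Ln w)"
    unfolding c_def by (subst exp_of_nat_mult[symmetric]) (simp add: field_simps)
  then have c: "c ^ (d ^ n) = inverse w" using w by (simp add: exp_minus)
  have "c \<noteq> 0" by (simp add: c_def)
  show thesis
  proof (rule that)
    show "c *s x \<noteq> 0" using \<open>c \<noteq> 0\<close> x by simp
    show "hpoint (c *s x) = q" using \<open>c \<noteq> 0\<close> x by (simp add: hpoint_scale)
    show "(F ^^ n) (c *s x) = affine_coords i ((f ^^ n) q)"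
      unfolding x(2) funpow_F_scale c funpow_F_lift[OF x(1)] affine_coords_hpoint[OF Fx]
      by (simp add: vec_eq_iff w_def divide_inverse mult.commute)
  qed
qed

text \<open>A rational function on projective space. It is the \<open>d ^ n\<close>-th power of the \<open>k\<close>-th coordinate
  of the representative \<open>s\<close> normalized by \<open>(F ^^ n) s $ i = 1\<close>; in contrast to that coordinate it is
  single-valued.\<close>

definition normalized_coord_power :: "nat \<Rightarrow> 'n \<Rightarrow> 'n \<Rightarrow> 'n cproj \<Rightarrow> complex" where
  "normalized_coord_power n i k q =
     (let x = (SOME x. x \<noteq> 0 \<and> hpoint x = q) in x $ k ^ (d ^ n) / (F ^^ n) x $ i)"

text \<open>Numerator and denominator are both homogeneous of degree \<open>d ^ n\<close>, so the
  choice made by \<open>SOME\<close> does not matter.\<close>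

lemma normalized_coord_power_hpoint:
  assumes "x \<noteq> 0"
  shows "normalized_coord_power n i k (hpoint x) = x $ k ^ (d ^ n) / (F ^^ n) x $ i"
proof -
  define y where "y = (SOME y. y \<noteq> 0 \<and> hpoint y = hpoint x)"
  have "y \<noteq> 0 \<and> hpoint y = hpoint x"
    unfolding y_def by (rule someI[of _ x]) (use assms in simp)
  then obtain c where c: "y = c *s x" "c \<noteq> 0"
    using hpoint_eq_iff[of x y] assms by (metis vector_smult_lzero)
  have "normalized_coord_power n i k (hpoint x) = y $ k ^ (d ^ n) / (F ^^ n) y $ i"
    by (simp add: normalized_coord_power_def y_def Let_def)
  then show ?thesis
    using c(2) unfolding c(1) funpow_F_scale by (simp add: power_mult_distrib)
qed

lemma holomorphic_on_normalized_coord_power: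
  assumes \<phi>: "holomorphic_disc M \<phi>"
    and U_def: "U = {z \<in> ball 0 1. in_chart i ((f ^^ n) (\<phi> z))}"
  shows "open U" "(\<lambda>z. normalized_coord_power n i k (\<phi> z)) holomorphic_on U"
proof -
  have "holomorphic_disc UNIV (f ^^ n \<circ> \<phi>)"
    by (rule holomorphic_disc_funpow[OF \<phi>]) simp
  from local_lift_chart[OF this, of i] show U: "open U"
    by (simp add: local_lift_def U_def)
  show "(\<lambda>z. normalized_coord_power n i k (\<phi> z)) holomorphic_on U"
  proof (rule holomorphic_on_local)
    fix z assume z: "z \<in> U"
    then have "z \<in> ball 0 1" by (simp add: U_def)
    then obtain T s where T: "z \<in> T" "local_lift T s \<phi>"
      using \<phi> unfolding holomorphic_disc_iff_local_lift by meson
    have s: "s w \<noteq> 0" "\<phi> w = hpoint (s w)" if "w \<in> T" for w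
      using T that by (auto simp: local_lift_def)
    have Fs: "local_lift T (\<lambda>w. (F ^^ n) (s w)) (\<lambda>w. (f ^^ n) (\<phi> w))"
      using T by (intro local_lift_funpow)
    have hol: "(\<lambda>w. s w $ k) holomorphic_on T \<inter> U" "(\<lambda>w. (F ^^ n) (s w) $ i) holomorphic_on T \<inter> U"
      using T Fs by (auto simp: local_lift_def intro: holomorphic_on_subset)
    have nz: "(F ^^ n) (s w) $ i \<noteq> 0" if "w \<in> T \<inter> U" for w
      using that s[of w] by (simp add: U_def funpow_F_lift in_chart_hpoint funpow_F_eq_0)
    have "(\<lambda>w. s w $ k ^ (d ^ n) / (F ^^ n) (s w) $ i) holomorphic_on T \<inter> U"
      by (intro holomorphic_intros hol nz)
    then have "(\<lambda>w. normalized_coord_power n i k (\<phi> w)) holomorphic_on T \<inter> U"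
      by (rule holomorphic_transform) (simp add: s normalized_coord_power_hpoint)
    then show "\<exists>T. open T \<and> z \<in> T \<and> (\<lambda>z. normalized_coord_power n i k (\<phi> z)) holomorphic_on T"
      using T U z by (intro exI[of _ "T \<inter> U"]) (auto simp: local_lift_def)
  qed
qed

text \<open>In a local lift the numerator is a power of a coordinate vanishing at
  \<open>\<epsilon>\<close>, and the denominator stays away from 0 in the chart.\<close>

lemma normalized_coord_power_zero_order:
  assumes \<phi>: "holomorphic_disc M \<phi>" and \<epsilon>: "\<epsilon> \<in> ball 0 1" "in_chart i ((f ^^ n) (\<phi> \<epsilon>))"
    and zero: "normalized_coord_power n i k (\<phi> \<epsilon>) = 0"
  shows "\<exists>K. eventually (\<lambda>z. cmod (normalized_coord_power n i k (\<phi> z)) \<le> K * cmod (z - \<epsilon>) ^ (d ^ n)) (at \<epsilon>)"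
proof -
  obtain T s where T: "\<epsilon> \<in> T" "local_lift T s \<phi>"
    using \<phi> \<epsilon> unfolding holomorphic_disc_iff_local_lift by meson
  have s: "s w \<noteq> 0" "\<phi> w = hpoint (s w)" if "w \<in> T" for w
    using T that by (auto simp: local_lift_def)
  have T': "open T" "(\<lambda>w. s w $ k) holomorphic_on T" using T by (auto simp: local_lift_def)
  define h where "h = (\<lambda>w. (F ^^ n) (s w) $ i)"
  have h: "h holomorphic_on T"
    using local_lift_funpow[OF T(2), of n] by (simp add: local_lift_def h_def)
  have h0: "h \<epsilon> \<noteq> 0"
    using s[OF T(1)] \<epsilon>(2) by (simp add: h_def funpow_F_lift in_chart_hpoint funpow_F_eq_0)
  have "s \<epsilon> $ k = 0"
    using zero h0 s[OF T(1)] by (simp add: normalized_coord_power_hpoint h_def)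
  then obtain K where K: "K > 0" "eventually (\<lambda>z. cmod (s z $ k) \<le> K * cmod (z - \<epsilon>)) (at \<epsilon>)"
    using holomorphic_zero_linear_bound[OF T'(2,1) T(1)] by metis
  have "isCont h \<epsilon>"
    using h T T' by (meson continuous_on_eq_continuous_at holomorphic_on_imp_continuous_on)
  then have "((\<lambda>z. cmod (h z)) \<longlongrightarrow> cmod (h \<epsilon>)) (at \<epsilon>)"
    by (intro tendsto_norm) (simp add: isCont_def)
  then have ev: "eventually (\<lambda>z. cmod (h z) > cmod (h \<epsilon>) / 2) (at \<epsilon>)"
    using h0 by (intro order_tendstoD) auto
  have evT: "eventually (\<lambda>z. z \<in> T) (at \<epsilon>)"
    using T(1) T'(1) by (simp add: eventually_at_in_open')
  have "eventually (\<lambda>z. cmod (normalized_coord_power n i k (\<phi> z))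
      \<le> K ^ (d ^ n) / (cmod (h \<epsilon>) / 2) * cmod (z - \<epsilon>) ^ (d ^ n)) (at \<epsilon>)"
    using K(2) ev evT
  proof eventually_elim
    case (elim z)
    have "cmod (normalized_coord_power n i k (\<phi> z)) = cmod (s z $ k) ^ (d ^ n) / cmod (h z)"
      using s[OF elim(3)] by (simp add: normalized_coord_power_hpoint h_def norm_divide norm_power)
    also have "\<dots> \<le> (K * cmod (z - \<epsilon>)) ^ (d ^ n) / (cmod (h \<epsilon>) / 2)"
      using elim h0 K(1) by (intro frac_le power_mono) auto
    finally show ?case by (simp add: power_mult_distrib mult_ac)
  qed
  then show ?thesis by blast
qed

text \<open>What matters is that \<open>C0\<close> does not depend on \<open>n\<close>:
  \<open>funpow_F_confined\<close> bounds the normalized representatives uniformly, and the exponent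
  \<open>d ^ n\<close> disappears when roots are taken.\<close>

lemma disc_estimate:
  fixes i :: 'n
  obtains C0 where "C0 > 0"
    "\<And>\<phi> n z. holomorphic_disc UNIV \<phi> \<Longrightarrow>
       (\<And>w. w \<in> cball 0 (1/2) \<Longrightarrow> in_chart i ((f ^^ n) (\<phi> w)) \<and>
          norm (affine_coords i ((f ^^ n) (\<phi> w))) \<le> C) \<Longrightarrow>
       z \<in> ball 0 1 \<Longrightarrow> dist (\<phi> 0) (\<phi> z) \<le> C0 * cmod z"
proof -
  obtain r R where rR: "r > 0" "R > 0" "\<And>n x. 1 \<le> norm ((F ^^ n) x) \<Longrightarrow> r \<le> norm x"
    "\<And>n x. norm ((F ^^ n) x) \<le> C \<Longrightarrow> norm x \<le> R"
    using funpow_F_confined[of C] by metis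
  obtain L where L: "L > 0" "\<And>x y :: complex^'n. r \<le> norm x \<Longrightarrow> r \<le> norm y \<Longrightarrow>
      dist (hpoint x) (hpoint y) \<le> L * norm (x - y)"
    using hpoint_lipschitz[OF rR(1)] by metis
  \<comment> \<open>A bound for the diameter of projective space; it settles the points with
    \<open>cmod z \<ge> \<delta>\<close>.\<close>
  obtain e where "\<forall>x\<in>UNIV. \<forall>y\<in>UNIV. dist (x :: 'n cproj) y \<le> e"
    using compact_imp_bounded[OF compact_cproj] bounded_two_points by metis
  then have e: "dist (x :: 'n cproj) y \<le> e" for x y by blast
  define N where "N = real CARD('n)"
  have N: "N > 0" by (simp add: N_def)
  \<comment> \<open>A vector of norm at least \<open>r\<close> has a coordinate of modulus at least
    \<open>r / N\<close>.\<close>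
  define \<rho> where "\<rho> = r / N"
  have \<rho>: "\<rho> > 0" using rR N by (simp add: \<rho>_def)
  \<comment> \<open>A zero \<open>w\<close> of the selected power forces
    \<open>\<rho> / 2 \<le> (R + \<rho>) * cmod w\<close>; for \<open>cmod w < \<delta>\<close> the
    right side is at most \<open>\<rho> / 4\<close>.\<close>
  define \<delta> where "\<delta> = \<rho> / (R + \<rho>) / 4"
  have \<delta>: "\<delta> > 0" using \<rho> rR by (simp add: \<delta>_def)
  have "\<rho> * 2 < 4 * R + 4 * \<rho>" using \<rho> rR by simp
  then have \<delta>2: "\<delta> < 1/2" using \<rho> rR by (simp add: \<delta>_def divide_simps)
  define C0 where "C0 = L * (N * (3 * R / \<delta>)) + \<bar>e\<bar> / \<delta>"
  have C0: "C0 > 0" using L N rR \<delta> by (simp add: C0_def add_pos_nonneg)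
  have "dist (\<phi> 0) (\<phi> z) \<le> C0 * cmod z"
    if \<phi>: "holomorphic_disc UNIV \<phi>"
      and chart: "\<And>w. w \<in> cball 0 (1/2) \<Longrightarrow> in_chart i ((f ^^ n) (\<phi> w))"
      and bound: "\<And>w. w \<in> cball 0 (1/2) \<Longrightarrow> norm (affine_coords i ((f ^^ n) (\<phi> w))) \<le> C"
      and z: "z \<in> ball 0 1"
    for \<phi> n z
  proof (cases "cmod z < \<delta>")
    case False
    have "dist (\<phi> 0) (\<phi> z) \<le> \<bar>e\<bar> * 1" using e[of "\<phi> 0" "\<phi> z"] by simp
    also have "\<dots> \<le> \<bar>e\<bar> * (cmod z / \<delta>)"
      using False \<delta> by (intro mult_left_mono) auto
    also have "\<dots> \<le> C0 * cmod z"
      using L N rR \<delta> by (simp add: C0_def algebra_simps)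
    finally show ?thesis .
  next
    case True
    define D where "D = d ^ n"
    have D: "D > 0" using degree by (simp add: D_def)
    define E where "E = (\<lambda>k z. normalized_coord_power n i k (\<phi> z))"
    define U where "U = {z \<in> ball 0 1. in_chart i ((f ^^ n) (\<phi> z))}"
    have U: "open U" "\<And>k. E k holomorphic_on U"
      using holomorphic_on_normalized_coord_power[OF \<phi> U_def] by (simp_all add: E_def)
    have sub: "cball 0 (1/2) \<subseteq> U" using chart by (auto simp: U_def)
    \<comment> \<open>The representative \<open>s\<close> is chosen point by point and need not be
      continuous in \<open>w\<close>; only the powers of its coordinates are used as
      functions.\<close>
    have rep: "\<exists>s. (\<forall>k. E k w = s $ k ^ D) \<and> r \<le> norm s \<and> norm s \<le> R" if w: "w \<in> cball 0 (1/2)" for w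
    proof -
      obtain s where s: "s \<noteq> 0" "hpoint s = \<phi> w" "(F ^^ n) s = affine_coords i ((f ^^ n) (\<phi> w))"
        using normalized_representative[OF chart[OF w]] by metis
      have one: "(F ^^ n) s $ i = 1" using s(3) chart[OF w] by (simp add: affine_coords_self)
      then have "1 \<le> norm ((F ^^ n) s)"
        using Finite_Cartesian_Product.norm_nth_le[of "(F ^^ n) s" i] by simp
      moreover have "norm ((F ^^ n) s) \<le> C" using s bound[OF w] by simp
      moreover have "E k w = s $ k ^ D" for k
        using normalized_coord_power_hpoint[OF s(1), of n i k] s(2) one by (simp add: E_def D_def)
      ultimately show ?thesis using rR by blast
    qed
    have bd: "cmod (E k w) \<le> R ^ D" if w: "w \<in> cball 0 (1/2)" for k w
    proof -
      obtain s where s: "E k w = s $ k ^ D" "norm s \<le> R" using rep[OF w] by blast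
      have "cmod (s $ k) \<le> R" using s Finite_Cartesian_Product.norm_nth_le[of s k] by simp
      then show ?thesis using s by (simp add: norm_power power_mono)
    qed
    obtain s0 where s0: "\<And>k. E k 0 = s0 $ k ^ D" "r \<le> norm s0" using rep[of 0] by auto
    have "\<exists>k. \<rho> \<le> cmod (s0 $ k)"
    proof (rule ccontr)
      assume "\<not> ?thesis"
      then have "(\<Sum>k\<in>UNIV. cmod (s0 $ k)) < (\<Sum>k\<in>(UNIV::'n set). \<rho>)"
        by (intro sum_strict_mono) (auto simp: not_le)
      also have "\<dots> = r" using N by (simp add: \<rho>_def N_def)
      finally show False using s0(2) norm_le_sum_nth[of s0] by linarith
    qed
    then obtain k where k: "\<rho> \<le> cmod (s0 $ k)" by blast
    have Enz: "E k w \<noteq> 0" if w: "w \<in> ball 0 \<delta>" for w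
    proof
      assume zero: "E k w = 0"
      have w': "cmod w < 1/2" "cmod w < \<delta>" using w \<delta>2 by auto
      then have ic: "in_chart i ((f ^^ n) (\<phi> w))" by (intro chart) simp
      obtain K where K: "eventually (\<lambda>z. cmod (E k z) \<le> K * cmod (z - w) ^ D) (at w)"
        using normalized_coord_power_zero_order[OF \<phi> _ ic, of k] zero w' by (auto simp: E_def D_def)
      \<comment> \<open>Since \<open>E k 0\<close> is itself a \<open>D\<close>-th power, so are
        both sides; taking roots removes \<open>n\<close> from the estimate.\<close>
      have "cmod (E k 0) * (1/2 - cmod w) ^ D \<le> (R * cmod w) ^ D"
        using rR by (intro high_order_zero_bound[OF U(2) U(1) sub bd _ w'(1) zero K]) auto
      then have pow: "(cmod (s0 $ k) * (1/2 - cmod w)) ^ D \<le> (R * cmod w) ^ D"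
        by (simp add: s0 norm_power power_mult_distrib)
      have "0 \<le> cmod (s0 $ k) * (1/2 - cmod w)" "0 \<le> R * cmod w"
        using rR(2) w'(1) by simp_all
      then have "cmod (s0 $ k) * (1/2 - cmod w) \<le> R * cmod w"
        using pow power_mono_iff[OF _ _ D] by blast
      moreover have "\<rho> * (1/2 - cmod w) \<le> cmod (s0 $ k) * (1/2 - cmod w)"
        using k w' by (intro mult_right_mono) auto
      ultimately have "\<rho> / 2 \<le> (R + \<rho>) * cmod w" by (simp add: algebra_simps)
      also have "\<dots> \<le> (R + \<rho>) * \<delta>" using w' \<rho> rR by (intro mult_left_mono) auto
      finally have le: "\<rho> / 2 \<le> (R + \<rho>) * \<delta>" .
      have "R + \<rho> \<noteq> 0" using \<rho> rR(2) by linarith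
      moreover have "a * (\<rho> / a / 4) = \<rho> / 4" if "a \<noteq> 0" for a :: real using that by simp
      ultimately have "(R + \<rho>) * \<delta> = \<rho> / 4" unfolding \<delta>_def by blast
      with le \<rho> show False by simp
    qed
    have "E k holomorphic_on ball 0 \<delta>"
    proof (rule holomorphic_on_subset[OF U(2)])
      have "ball 0 \<delta> \<subseteq> cball (0::complex) (1/2)" using \<delta>2 by auto
      then show "ball 0 \<delta> \<subseteq> U" using sub by (rule subset_trans)
    qed
    then obtain g where g: "g holomorphic_on ball 0 \<delta>" "\<And>w. w \<in> ball 0 \<delta> \<Longrightarrow> E k w = exp (g w)"
      using contractible_imp_holomorphic_log[of "E k" "ball 0 \<delta>"] Enz
        convex_imp_contractible[OF convex_ball] by metis
    define c where "c = (\<lambda>w. exp (g w / of_nat D))"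
    have c: "c holomorphic_on ball 0 \<delta>"
      unfolding c_def using g(1) D by (intro holomorphic_intros) auto
    have cD: "c w ^ D = E k w" if "w \<in> ball 0 \<delta>" for w
      using g(2)[OF that] D unfolding c_def by (subst exp_of_nat_mult[symmetric]) simp
    \<comment> \<open>Coordinate \<open>k\<close> of \<open>t\<close> is \<open>c\<close>, which
      makes \<open>t\<close> normalized: \<open>(F ^^ n) (t w) $ i = 1\<close>. Unlike the pointwise
      representatives, it is holomorphic.\<close>
    define t where "t = (\<lambda>w. c w *s affine_coords k (\<phi> w))"
    have half: "w \<in> cball 0 (1/2)" "w \<in> ball 0 1" if "w \<in> ball 0 \<delta>" for w :: complex
      using that \<delta>2 by auto
    have ik: "in_chart k (\<phi> w)" if w: "w \<in> ball 0 \<delta>" for w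
    proof -
      obtain x where x: "x \<noteq> 0" "\<phi> w = hpoint x" by (rule hpoint_cases)
      have "x $ k ^ D \<noteq> 0"
        using Enz[OF w] x D by (auto simp: E_def normalized_coord_power_hpoint D_def)
      then show ?thesis using x D by (simp add: in_chart_hpoint)
    qed
    have t: "hpoint (t w) = \<phi> w" "r \<le> norm (t w)" "\<And>l. cmod (t w $ l) \<le> R"
      if w: "w \<in> ball 0 \<delta>" for w
    proof -
      define x where "x = affine_coords k (\<phi> w)"
      have x: "x \<noteq> 0" "hpoint x = \<phi> w" "x $ k = 1"
        using ik[OF w] by (simp_all add: x_def affine_coords_nonzero hpoint_affine_coords affine_coords_self)
      have E: "E l w = x $ l ^ D / (F ^^ n) x $ i" for l
        using normalized_coord_power_hpoint[OF x(1), of n i l] x(2) by (simp add: E_def D_def)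
      have tl: "t w $ l ^ D = E l w" for l
        using cD[OF w] E[of k] E[of l] x(3) by (simp add: t_def x_def[symmetric] power_mult_distrib)
      have "c w \<noteq> 0" by (simp add: c_def)
      then show "hpoint (t w) = \<phi> w" using x by (simp add: t_def x_def[symmetric] hpoint_scale)
      have "(F ^^ n) (t w) = c w ^ D *s (F ^^ n) x"
        by (simp add: t_def x_def[symmetric] funpow_F_scale D_def)
      then have "(F ^^ n) (t w) $ i = 1"
        using cD[OF w] E[of k] x(3) Enz[OF w] by simp
      then have "1 \<le> norm ((F ^^ n) (t w))"
        using Finite_Cartesian_Product.norm_nth_le[of "(F ^^ n) (t w)" i] by simp
      then show "r \<le> norm (t w)" by (rule rR(3))
      fix l
      have "cmod (t w $ l) ^ D \<le> R ^ D"
        using bd[OF half(1)[OF w], of l] by (simp add: tl[symmetric] norm_power)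
      then show "cmod (t w $ l) \<le> R" using D rR by (simp add: power_mono_iff)
    qed
    have hol: "(\<lambda>w. t w $ l) holomorphic_on ball 0 \<delta>" for l
    proof -
      have "(\<lambda>w. affine_coords k (\<phi> w) $ l) holomorphic_on ball 0 \<delta>"
        using \<phi> half ik unfolding holomorphic_disc_def
        by (metis (mono_tags, lifting) holomorphic_on_subset mem_Collect_eq subsetI)
      then show ?thesis unfolding t_def vector_smult_component by (intro holomorphic_intros c)
    qed
    have z': "z \<in> ball 0 \<delta>" and z0: "0 \<in> ball 0 \<delta>" using True \<delta> by auto
    \<comment> \<open>The Schwarz estimate is applied to each coordinate of the lift;
      \<open>hpoint_lipschitz\<close> then returns to projective space.\<close>
    have "norm (t z - t 0) \<le> N * (3 * R / \<delta> * cmod z)"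
      unfolding N_def vector_minus_component
      using bounded_holomorphic_lipschitz[OF hol t(3) rR(2) \<delta> z']
      by (intro norm_vec_le_card) simp
    then have "dist (\<phi> 0) (\<phi> z) \<le> L * (N * (3 * R / \<delta> * cmod z))"
      using L(2)[OF t(2)[OF z0] t(2)[OF z']] L(1) t(1)[OF z0] t(1)[OF z']
      by (smt (verit, best) mult_left_mono norm_minus_commute)
    also have "\<dots> \<le> C0 * cmod z" using \<delta> by (simp add: C0_def algebra_simps)
    finally show ?thesis .
  qed
  note main = this
  show thesis
  proof (rule that[OF C0])
    fix \<phi> n and z :: complex
    assume "holomorphic_disc UNIV \<phi>" "z \<in> ball 0 1"
      and *: "\<And>w. w \<in> cball 0 (1/2) \<Longrightarrow> in_chart i ((f ^^ n) (\<phi> w)) \<and>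
          norm (affine_coords i ((f ^^ n) (\<phi> w))) \<le> C"
    then show "dist (\<phi> 0) (\<phi> z) \<le> C0 * cmod z"
      by (intro main[where n = n]) (simp_all only: *)
  qed
qed

section \<open>Fatou components\<close>

text \<open>Since \<open>f ^^ Suc n = f ^^ n \<circ> f\<close>, normality pulls back to the preimage
  of \<open>U\<close>.\<close>

lemma fatou_set_vimage: "f q \<in> fatou_set f \<Longrightarrow> q \<in> fatou_set f"
proof -
  assume "f q \<in> fatou_set f"
  then obtain U where U: "open U" "f q \<in> U" "normal_iterates_on U f"
    by (auto simp: fatou_set_def)
  have "open (f -` U)"
    using continuous_on_f[of UNIV] U(1) by (simp add: open_vimage)
  moreover have "normal_iterates_on (f -` U) f"
    unfolding normal_iterates_on_def
  proof
    fix \<sigma> :: "nat \<Rightarrow> nat"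
    show "\<exists>r g. strict_mono r \<and> (\<forall>K. compact K \<and> K \<subseteq> f -` U \<longrightarrow>
        uniform_limit K (\<lambda>j. f ^^ \<sigma> (r j)) g sequentially)"
    \<comment> \<open>The iterate of index 0 does not factor through \<open>f\<close>. If it occurs
      infinitely often, it gives a constant subsequence; otherwise it is discarded.\<close>
    proof (cases "infinite {j. \<sigma> j = 0}")
      case True
      define r where "r = enumerate {j. \<sigma> j = 0}"
      have "strict_mono r" "\<And>j. \<sigma> (r j) = 0"
        using True enumerate_in_set[OF True] by (auto simp: r_def strict_mono_enumerate)
      then show ?thesis
        by (intro exI[of _ r] exI[of _ id]) (auto simp: uniform_limit_const id_def)
    next
      case False
      have "{j. \<sigma> j \<noteq> 0} = - {j. \<sigma> j = 0}" by auto
      with False have inf: "infinite {j. \<sigma> j \<noteq> 0}" by (metis finite_compl infinite_UNIV_nat)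
      define r where "r = enumerate {j. \<sigma> j \<noteq> 0}"
      have r: "strict_mono r" "\<And>j. \<sigma> (r j) \<noteq> 0"
        using inf enumerate_in_set[OF inf] by (auto simp: r_def strict_mono_enumerate)
      define \<tau> where "\<tau> = (\<lambda>j. \<sigma> (r j) - 1)"
      obtain r' g where r': "strict_mono r'"
        "\<And>K. compact K \<Longrightarrow> K \<subseteq> U \<Longrightarrow> uniform_limit K (\<lambda>j. f ^^ \<tau> (r' j)) g sequentially"
        using U(3) unfolding normal_iterates_on_def by meson
      have it: "f ^^ \<sigma> (r j) = f ^^ \<tau> j \<circ> f" for j
        using r(2)[of j] funpow_Suc_right[of "\<tau> j" f] by (simp add: \<tau>_def)
      have "uniform_limit K (\<lambda>j. f ^^ \<sigma> ((r \<circ> r') j)) (g \<circ> f) sequentially"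
        if K: "compact K" "K \<subseteq> f -` U" for K
      proof -
        have "uniform_limit (f ` K) (\<lambda>j. f ^^ \<tau> (r' j)) g sequentially"
          using K by (intro r'(2) compact_continuous_image continuous_on_f) auto
        then show ?thesis
          unfolding uniform_limit_iff by (simp add: it)
      qed
      then show ?thesis
        using strict_mono_o[OF r(1) r'(1)] by blast
    qed
  qed
  ultimately show "q \<in> fatou_set f"
    using U(2) by (auto simp: fatou_set_def)
qed

lemma fatou_set_funpow_vimage: "(f ^^ n) q \<in> fatou_set f \<Longrightarrow> q \<in> fatou_set f"
  by (induction n) (auto dest: fatou_set_vimage)

lemma open_fatou_set: "open (fatou_set f)"
  by (subst open_subopen) (auto simp: fatou_set_def subset_eq)

text \<open>The closed half disc has compact image, so some iterate takes it into a fixed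
  neighborhood of \<open>p\<close> in one chart. That iterate depends on the disc, but the constant
  of \<open>disc_estimate\<close> does not.\<close>

lemma fatou_component_dist_le_kobayashi_dist:
  assumes p: "in_chart i p" and M: "M \<in> fatou_components f"
    and iter: "\<And>K e. compact K \<Longrightarrow> K \<subseteq> M \<Longrightarrow> e > 0 \<Longrightarrow> \<exists>n. \<forall>q\<in>K. dist ((f ^^ n) q) p < e"
  obtains C where "C > 0" "\<And>x y. x \<in> M \<Longrightarrow> y \<in> M \<Longrightarrow> dist x y \<le> C * kobayashi_dist M x y"
proof -
  define c where "c = norm (affine_coords i p) + 1"
  have "isCont (affine_coords i) p"
    using continuous_on_affine_coords[of i] open_in_chart[of i] p
    by (simp add: continuous_on_eq_continuous_at)
  then have "((\<lambda>q. norm (affine_coords i q)) \<longlongrightarrow> norm (affine_coords i p)) (nhds p)"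
    by (simp add: isCont_def tendsto_norm tendsto_at_iff_tendsto_nhds)
  then have "eventually (\<lambda>q. norm (affine_coords i q) < c) (nhds p)"
    by (rule order_tendstoD) (simp add: c_def)
  moreover have "eventually (\<lambda>q. in_chart i q) (nhds p)"
    using eventually_nhds_in_open[OF open_in_chart[of i], of p] p by simp
  ultimately have "eventually (\<lambda>q. in_chart i q \<and> norm (affine_coords i q) < c) (nhds p)"
    by (rule eventually_conj[rotated])
  then obtain e where e: "e > 0" "\<And>q. dist q p < e \<Longrightarrow> in_chart i q \<and> norm (affine_coords i q) < c"
    unfolding eventually_nhds_metric by blast
  obtain C where C: "C > 0" "\<And>\<phi> n z. holomorphic_disc UNIV \<phi> \<Longrightarrow>
       (\<And>w. w \<in> cball 0 (1/2) \<Longrightarrow> in_chart i ((f ^^ n) (\<phi> w)) \<and>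
          norm (affine_coords i ((f ^^ n) (\<phi> w))) \<le> c) \<Longrightarrow>
       z \<in> ball 0 1 \<Longrightarrow> dist (\<phi> 0) (\<phi> z) \<le> C * cmod z"
    using disc_estimate[of i c] by metis
  show thesis
  proof (rule that[OF C(1)], rule dist_le_kobayashi_dist)
    show "open M" using open_component_cproj[OF open_fatou_set M] .
    show "connected M" using M in_components_connected by blast
    show "0 \<le> C" using C(1) by simp
    fix \<phi> z assume \<phi>: "holomorphic_disc M \<phi>" and z: "z \<in> ball (0::complex) 1"
    have comp: "compact (\<phi> ` cball 0 (1/2))"
      using \<phi> by (intro compact_continuous_image compact_cball)
        (auto simp: holomorphic_disc_def elim!: continuous_on_subset)
    have "\<phi> ` cball 0 (1/2) \<subseteq> M"
    proof -
      have "cball 0 (1/2) \<subseteq> ball (0::complex) 1" by auto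
      then show ?thesis using \<phi> unfolding holomorphic_disc_def by blast
    qed
    from iter[OF comp this e(1)]
    obtain n where "\<forall>q\<in>\<phi> ` cball 0 (1/2). dist ((f ^^ n) q) p < e" ..
    then have n: "dist ((f ^^ n) (\<phi> w)) p < e" if "w \<in> cball 0 (1/2)" for w
      using that by blast
    show "dist (\<phi> 0) (\<phi> z) \<le> C * cmod z"
    proof (rule C(2)[OF _ _ z])
      show "holomorphic_disc UNIV \<phi>" using \<phi> unfolding holomorphic_disc_def by blast
      show "in_chart i ((f ^^ n) (\<phi> w)) \<and> norm (affine_coords i ((f ^^ n) (\<phi> w))) \<le> c"
        if "w \<in> cball 0 (1/2)" for w
        using e(2)[OF n[OF that]] by simp
    qed
  qed
qed

section \<open>Completeness of components mapped into the basin\<close>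

lemma kobayashi_complete_fatou_component:
  assumes \<Omega>: "\<Omega> \<in> fatou_components f" and W: "W = (f ^^ m) ` \<Omega>" and basin: "basin_of_attraction f k p W"
  shows "kobayashi_complete \<Omega>"
proof -
  have WF: "W \<in> fatou_components f" and pW: "p \<in> W" and fW: "(f ^^ k) ` W = W"
    and lim: "\<And>K. compact K \<Longrightarrow> K \<subseteq> W \<Longrightarrow> uniform_limit K (\<lambda>j. (f ^^ k) ^^ j) (\<lambda>_. p) sequentially"
    using basin by (auto simp: basin_of_attraction_def)
  have op: "open \<Omega>" "open W" using open_component_cproj[OF open_fatou_set] \<Omega> WF by auto
  have con: "connected \<Omega>" using \<Omega> in_components_connected by blast
  have fkj: "(f ^^ k) ^^ j = f ^^ (k * j)" for j by (simp add: funpow_mult)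
  have fkjW: "(f ^^ (k * j)) ` W = W" for j
  proof (induction j)
    case (Suc j)
    have "(f ^^ (k * Suc j)) ` W = (f ^^ k) ` (f ^^ (k * j)) ` W"
      by (simp add: funpow_add image_image)
    with Suc fW show ?case by simp
  qed simp
  have iterW: "\<exists>j. \<forall>q\<in>K. dist ((f ^^ (k * j)) q) p < e" if "compact K" "K \<subseteq> W" "e > 0" for K e
    using eventually_happens'[OF sequentially_bot uniform_limitD[OF lim[OF that(1,2)] that(3)]]
    by (simp only: fkj)
  have iter\<Omega>: "\<exists>j. \<forall>q\<in>K. dist ((f ^^ (k * j + m)) q) p < e" if "compact K" "K \<subseteq> \<Omega>" "e > 0" for K e
    using iterW[of "(f ^^ m) ` K" e] that W
    by (auto simp: funpow_add intro: compact_continuous_image continuous_on_funpow_f)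
  have nW: "\<exists>n. \<forall>q\<in>K. dist ((f ^^ n) q) p < e" if "compact K" "K \<subseteq> W" "e > 0" for K e
    using iterW[OF that] by blast
  have n\<Omega>: "\<exists>n. \<forall>q\<in>K. dist ((f ^^ n) q) p < e" if "compact K" "K \<subseteq> \<Omega>" "e > 0" for K e
    using iter\<Omega>[OF that] by blast
  obtain i where i: "in_chart i p" using ex_in_chart by blast
  obtain C where C: "C > 0" "\<And>x y. x \<in> \<Omega> \<Longrightarrow> y \<in> \<Omega> \<Longrightarrow> dist x y \<le> C * kobayashi_dist \<Omega> x y"
    using fatou_component_dist_le_kobayashi_dist[OF i \<Omega> n\<Omega>] by metis
  obtain C' where C': "C' > 0" "\<And>x y. x \<in> W \<Longrightarrow> y \<in> W \<Longrightarrow> dist x y \<le> C' * kobayashi_dist W x y"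
    using fatou_component_dist_le_kobayashi_dist[OF i WF nW] by metis
  have hyp: "kobayashi_hyperbolic \<Omega>"
    using kobayashi_hyperbolic_if_dist_le[OF op(1) con C(2)] .
  then interpret K: Metric_space \<Omega> "kobayashi_dist \<Omega>"
    by (simp add: kobayashi_hyperbolic_def)
  have "K.mcomplete"
    unfolding K.mcomplete_def
  proof (intro allI impI)
    fix \<sigma> :: "nat \<Rightarrow> 'n cproj" assume cauchy: "K.MCauchy \<sigma>"
    then have \<sigma>: "\<And>n. \<sigma> n \<in> \<Omega>" by (auto simp: K.MCauchy_def)
    \<comment> \<open>The ball is closed so that a limit of images stays in
      \<open>W\<close>.\<close>
    obtain e where e: "e > 0" "cball p e \<subseteq> W" using op(2) pW open_contains_cball by blast
    \<comment> \<open>The tolerance involves the constant of \<open>W\<close>, because the distances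
      are compared after mapping \<open>\<Omega>\<close> to \<open>W\<close>.\<close>
    obtain N where N: "\<And>n. n \<ge> N \<Longrightarrow> kobayashi_dist \<Omega> (\<sigma> N) (\<sigma> n) < e / 2 / C'"
      using cauchy e(1) C'(1) unfolding K.MCauchy_def by (metis divide_pos_pos half_gt_zero order_refl)
    \<comment> \<open>Only the single point \<open>\<sigma> N\<close> has to be brought close to
      \<open>p\<close>; the tail follows because \<open>h\<close> does not increase Kobayashi
      distances.\<close>
    obtain j where j: "dist ((f ^^ (k * j + m)) (\<sigma> N)) p < e / 2"
      using iter\<Omega>[of "{\<sigma> N}" "e / 2"] \<sigma> e(1) by auto
    define h where "h = f ^^ (k * j + m)"
    have "h ` \<Omega> = (f ^^ (k * j)) ` (f ^^ m) ` \<Omega>" by (simp add: h_def funpow_add image_image)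
    then have h\<Omega>: "h ` \<Omega> = W" using fkjW[of j] W by simp
    have near: "h (\<sigma> n) \<in> cball p e" if n: "n \<ge> N" for n
    proof -
      obtain s0 where s0: "disc_chain \<Omega> (\<sigma> N) (\<sigma> n) s0"
        using disc_chain_exists[OF op(1) con] \<sigma> by blast
      obtain s where s: "disc_chain \<Omega> (\<sigma> N) (\<sigma> n) s" "s < e / 2 / C'"
        using kobayashi_dist_less_imp[OF s0 N[OF n]] by blast
      have "disc_chain W (h (\<sigma> N)) (h (\<sigma> n)) s"
        using s(1)
      proof (rule disc_chain_map)
        show "holomorphic_disc W (h \<circ> \<phi>)" if "holomorphic_disc \<Omega> \<phi>" for \<phi>
          using holomorphic_disc_funpow[OF that] h\<Omega> by (simp add: h_def)
      qed (simp add: h\<Omega>)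
      then have "kobayashi_dist W (h (\<sigma> N)) (h (\<sigma> n)) < e / 2 / C'"
        using s(2) by (blast intro: le_less_trans kobayashi_dist_le)
      then have "C' * kobayashi_dist W (h (\<sigma> N)) (h (\<sigma> n)) < e / 2"
        using C'(1) by (simp add: field_simps)
      moreover have "dist (h (\<sigma> N)) (h (\<sigma> n)) \<le> C' * kobayashi_dist W (h (\<sigma> N)) (h (\<sigma> n))"
        using \<sigma> h\<Omega> by (intro C'(2)) auto
      ultimately have "dist (h (\<sigma> N)) (h (\<sigma> n)) < e / 2" by simp
      then show ?thesis
        using j dist_triangle[of p "h (\<sigma> n)" "h (\<sigma> N)"] by (simp add: h_def dist_commute)
    qed
    obtain x r where xr: "strict_mono r" "(\<sigma> \<circ> r) \<longlonglongrightarrow> x"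
      using compact_cproj unfolding compact_def by (metis UNIV_I)
    have "isCont h x"
      using continuous_on_funpow_f[of UNIV] by (simp add: h_def continuous_on_eq_continuous_at)
    then have "(\<lambda>n. h ((\<sigma> \<circ> r) n)) \<longlonglongrightarrow> h x"
      using xr(2) by (rule isCont_tendsto_compose)
    moreover have "eventually (\<lambda>n. h ((\<sigma> \<circ> r) n) \<in> cball p e) sequentially"
      using near seq_suble[OF xr(1)] unfolding eventually_sequentially
      by (metis comp_apply order_trans)
    ultimately have "h x \<in> cball p e"
      using Lim_in_closed_set[OF closed_cball] by (metis sequentially_bot)
    \<comment> \<open>A limit in projective space might lie on the boundary of
      \<open>\<Omega>\<close>; being in the Fatou set excludes this.\<close>
    then have "h x \<in> fatou_set f" using e(2) WF in_components_subset by blast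
    then have xF: "x \<in> fatou_set f" unfolding h_def by (rule fatou_set_funpow_vimage)
    have "x \<in> \<Omega>"
    proof -
      obtain T where T: "closed T" "\<Omega> = fatou_set f \<inter> T"
        using closedin_component[OF \<Omega>] by (auto simp: closedin_closed)
      have "x \<in> T"
        using T \<sigma> xr(2) by (intro Lim_in_closed_set[OF T(1) _ _ xr(2)]) auto
      then show ?thesis using T xF by blast
    qed
    \<comment> \<open>Short discs around \<open>x\<close> turn convergence in projective space into
      convergence for the Kobayashi distance.\<close>
    have "limitin K.mtopology (\<sigma> \<circ> r) x sequentially"
      unfolding K.limit_metric_sequentially
    proof (intro conjI allI impI)
      fix \<epsilon> :: real assume "\<epsilon> > 0"
      then obtain \<eta> where \<eta>: "\<eta> > 0" "\<And>q. dist q x < \<eta> \<Longrightarrow> \<exists>s<\<epsilon>. disc_chain \<Omega> x q s"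
        using short_disc_chain[OF op(1) \<open>x \<in> \<Omega>\<close>] by metis
      obtain n0 where n0: "\<And>n. n \<ge> n0 \<Longrightarrow> dist ((\<sigma> \<circ> r) n) x < \<eta>"
        using xr(2) \<eta>(1) unfolding lim_sequentially by blast
      have "(\<sigma> \<circ> r) n \<in> \<Omega> \<and> kobayashi_dist \<Omega> ((\<sigma> \<circ> r) n) x < \<epsilon>" if "n \<ge> n0" for n
        using \<eta>(2)[OF n0[OF that]] \<sigma> kobayashi_dist_le
        by (metis comp_apply kobayashi_dist_commute le_less_trans)
      then show "\<exists>n0. \<forall>n\<ge>n0. (\<sigma> \<circ> r) n \<in> \<Omega> \<and> kobayashi_dist \<Omega> ((\<sigma> \<circ> r) n) x < \<epsilon>" by blast
    qed (rule \<open>x \<in> \<Omega>\<close>)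
    then show "\<exists>x. limitin K.mtopology \<sigma> x sequentially"
      using K.MCauchy_convergent_subsequence[OF cauchy xr(1)] by blast
  qed
  with hyp show ?thesis by (simp add: kobayashi_complete_def)
qed

end

theorem theorem7:
  fixes f :: "'n::finite cproj \<Rightarrow> 'n cproj" and d m k :: nat
    and \<Omega> W :: "'n cproj set" and p :: "'n cproj"
  assumes "CARD('n) \<ge> 2"
    and "holomorphic_selfmap d f" and "d \<ge> 2"
    and "\<Omega> \<in> fatou_components f"
    and "k \<ge> 1"
    and "W = (f ^^ m) ` \<Omega>"
    and "basin_of_attraction f k p W"
  shows "kobayashi_complete \<Omega>"
proof -
  obtain F where "\<And>i. homogeneous_polynomial d (\<lambda>x. F x $ i)" "\<And>x. F x = 0 \<longleftrightarrow> x = 0"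
    "\<And>x. x \<noteq> 0 \<Longrightarrow> f (hpoint x) = hpoint (F x)"
    using assms(2) unfolding holomorphic_selfmap_def by meson
  then interpret homogeneous_lift d F f
    using assms(3) by unfold_locales
  show ?thesis by (rule kobayashi_complete_fatou_component) fact+
qed

end
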